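(* Let $d=1$, and let $w:\mathbb Z\to[0,\infty)$ be symmetric ($w(r)=w(-r)$) and lazy-bipartite, i.e. $w(r)=0$ for every even $r\neq0$; regard $w$ as the translation-invariant weight $w_{x,y}=w(y-x)$. Assume that $$w(0)>0,\qquad \sum_{r\in\mathbb Z}|r|\,w(r)<\infty .$$ Let $L_{\max}:=\max_{x\in\mathbb T_L}|\mathcal L_x|$. Then, for every $\varepsilon>0$, as $L\to\infty$ through even integers, $$\mathbb P^{\mathrm{mdd}}_{L,w}\bigl(L_{\max}\ge\varepsilon L\bigr)\to0,\qquad \frac1L\mathbb E^{\mathrm{mdd}}_{L,w}L_{\max}\to0,\qquad \frac1L\mathbb E^{\mathrm{mdd}}_{L,w}|\mathcal L_0|\to0,\qquad M^{\mathrm{mdd}}_{L,w}\to0 .$$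
   Context: $\mathbb T_L:=\mathbb Z/L\mathbb Z$. The periodised weights on $\mathbb T_L$ are $w^{(L)}_{x,y}:=\sum_{k\in\mathbb Z}w(y-x+kL)$. Monomer double-dimer model (mdd). Let $V$ be a finite set with symmetric weights $w_{x,y}\ge0$, $x,y\in V$, and let $E$ be the set of unordered pairs $\{x,y\}$, $x\ne y$, with $w_{x,y}>0$. For $m\in\{0,1\}^E$ put $n_x(m):=\sum_{y:\{x,y\}\in E}m_{x,y}$. Let $\Omega$ be the set of $(m^1,m^2)\in\{0,1\}^E\times\{0,1\}^E$ with $n_x(m^1)=n_x(m^2)\in\{0,1\}$ for all $x\in V$. The measure $\mathbb P^{\mathrm{mdd}}$ on $\Omega$ gives $(m^1,m^2)$ probability proportional, with normalising constant $Z^{\mathrm{mdd}}$, to $\prod_{x\in V}w_{x,x}^{1-n_x(m^1)}\prod_{\{x,y\}\in E}w_{x,y}^{m^1_{x,y}+m^2_{x,y}}$. The multigraph in which $\{u,v\}\in E$ has multiplicity $m^1_{u,v}+m^2_{u,v}$ is a disjoint union of loops (possibly a doubled edge) and isolated vertices (monomers); $\mathcal L_x$ is the loop containing $x$ ($\mathcal L_x=\{x\}$ if $x$ is a monomer), and $|\mathcal L_x|$ is the total number of dimers (edges of $m^1$ and $m^2$, with multiplicity) in it, so $|\mathcal L_x|=0$ iff $x$ is a monomer. For $x\neq y$ let $\Omega_{x,y}$ be the set of $(m^1,m^2)\in\{0,1\}^E\times\{0,1\}^E$ with $n_z(m^1)=n_z(m^2)\in\{0,1\}$ for $z\notin\{x,y\}$,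 $n_x(m^1)=n_y(m^1)=0$, $n_x(m^2)=n_y(m^2)=1$; then $$G^{\mathrm{mdd}}(x,y):=\frac1{Z^{\mathrm{mdd}}}\sum_{(m^1,m^2)\in\Omega_{x,y}}\ \prod_{z\in V\setminus\{x,y\}}w_{z,z}^{1-n_z(m^1)}\prod_{\{u,v\}\in E}w_{u,v}^{m^1_{u,v}+m^2_{u,v}},$$ and $G^{\mathrm{mdd}}(x,x):=0$. The subscript $_{L,w}$ means that the model is taken on $V=\mathbb T_L$ with weights $w^{(L)}$; $\mathbb E^{\mathrm{mdd}}_{L,w}$ is the expectation, and $M^{\mathrm{mdd}}_{L,w}:=\frac1L\sum_{x\in\mathbb T_L}G^{\mathrm{mdd}}_{L,w}(0,x)$. *)

theory Defs
  imports "HOL-Analysis.Analysis"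
begin

definition edges :: "'a set \<Rightarrow> ('a \<Rightarrow> 'a \<Rightarrow> real) \<Rightarrow> 'a set set" where
  "edges V W = {{x, y} | x y. x \<in> V \<and> y \<in> V \<and> x \<noteq> y \<and> W x y > 0}"

text \<open>The weight of an unordered pair; meaningful only for symmetric \<open>W\<close>.\<close>

definition edge_weight :: "('a \<Rightarrow> 'a \<Rightarrow> real) \<Rightarrow> 'a set \<Rightarrow> real" where
  "edge_weight W e = (THE c. \<exists>x y. e = {x, y} \<and> c = W x y)"

lemma edge_weight_pair:
  assumes "\<And>x y. W x y = W y x"
  shows "edge_weight W {x, y} = W x y"
  unfolding edge_weight_def
  by (rule the_equality) (use assms in \<open>auto simp: doubleton_eq_iff\<close>)

definition occ :: "'a set \<Rightarrow> ('a \<Rightarrow> 'a \<Rightarrow> real) \<Rightarrow> ('a set \<Rightarrow> nat) \<Rightarrow> 'a \<Rightarrow> nat" where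
  "occ V W m x = (\<Sum>y\<in>{y. {x, y} \<in> edges V W}. m {x, y})"

type_synonym 'a config = "('a set \<Rightarrow> nat) \<times> ('a set \<Rightarrow> nat)"

text \<open>Elements of \<open>{0,1}\<^sup>E\<close> are functions with value \<open>undefined\<close> outside \<open>E\<close>.\<close>

definition dimers :: "'a set \<Rightarrow> ('a \<Rightarrow> 'a \<Rightarrow> real) \<Rightarrow> ('a set \<Rightarrow> nat) set" where
  "dimers V W = edges V W \<rightarrow>\<^sub>E {0, 1}"

definition mdd_configs :: "'a set \<Rightarrow> ('a \<Rightarrow> 'a \<Rightarrow> real) \<Rightarrow> 'a config set" where
  "mdd_configs V W = {(m1, m2) \<in> dimers V W \<times> dimers V W.
     \<forall>x\<in>V. occ V W m1 x = occ V W m2 x \<and> occ V W m1 x \<in> {0, 1}}"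

text \<open>The weight of a configuration, with monomer weights collected over \<open>S\<close> only:
  \<open>S = V\<close> for the measure, and \<open>S = V - {x, y}\<close> for the two-point function.\<close>

definition config_weight ::
    "'a set \<Rightarrow> ('a \<Rightarrow> 'a \<Rightarrow> real) \<Rightarrow> 'a set \<Rightarrow> 'a config \<Rightarrow> real" where
  "config_weight V W S = (\<lambda>(m1, m2).
     (\<Prod>z\<in>S. W z z ^ (1 - occ V W m1 z)) *
     (\<Prod>e\<in>edges V W. edge_weight W e ^ (m1 e + m2 e)))"

definition mdd_Z :: "'a set \<Rightarrow> ('a \<Rightarrow> 'a \<Rightarrow> real) \<Rightarrow> real" where
  "mdd_Z V W = (\<Sum>\<omega>\<in>mdd_configs V W. config_weight V W V \<omega>)"

definition mdd_measure :: "'a set \<Rightarrow> ('a \<Rightarrow> 'a \<Rightarrow> real) \<Rightarrow> 'a config measure" where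
  "mdd_measure V W = point_measure (mdd_configs V W)
     (\<lambda>\<omega>. ennreal (config_weight V W V \<omega> / mdd_Z V W))"

definition loop_vertices :: "'a set \<Rightarrow> ('a \<Rightarrow> 'a \<Rightarrow> real) \<Rightarrow> 'a \<Rightarrow> 'a config \<Rightarrow> 'a set" where
  "loop_vertices V W x = (\<lambda>(m1, m2).
     {y. (x, y) \<in> {(u, v). {u, v} \<in> edges V W \<and> m1 {u, v} + m2 {u, v} > 0}\<^sup>*})"

definition loop_length :: "'a set \<Rightarrow> ('a \<Rightarrow> 'a \<Rightarrow> real) \<Rightarrow> 'a \<Rightarrow> 'a config \<Rightarrow> nat" where
  "loop_length V W x = (\<lambda>(m1, m2).
     \<Sum>e\<in>{e \<in> edges V W. e \<subseteq> loop_vertices V W x (m1, m2)}. m1 e + m2 e)"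

definition max_loop_length :: "'a set \<Rightarrow> ('a \<Rightarrow> 'a \<Rightarrow> real) \<Rightarrow> 'a config \<Rightarrow> nat" where
  "max_loop_length V W \<omega> = Max ((\<lambda>x. loop_length V W x \<omega>) ` V)"

definition mdd_configs2 :: "'a set \<Rightarrow> ('a \<Rightarrow> 'a \<Rightarrow> real) \<Rightarrow> 'a \<Rightarrow> 'a \<Rightarrow> 'a config set" where
  "mdd_configs2 V W x y = {(m1, m2) \<in> dimers V W \<times> dimers V W.
     (\<forall>z\<in>V - {x, y}. occ V W m1 z = occ V W m2 z \<and> occ V W m1 z \<in> {0, 1}) \<and>
     occ V W m1 x = 0 \<and> occ V W m1 y = 0 \<and> occ V W m2 x = 1 \<and> occ V W m2 y = 1}"

definition mdd_G :: "'a set \<Rightarrow> ('a \<Rightarrow> 'a \<Rightarrow> real) \<Rightarrow> 'a \<Rightarrow> 'a \<Rightarrow> real" where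
  "mdd_G V W x y = (if x = y then 0 else
     (1 / mdd_Z V W) * (\<Sum>\<omega>\<in>mdd_configs2 V W x y. config_weight V W (V - {x, y}) \<omega>))"

text \<open>\<open>\<int>/L\<int>\<close> is represented by \<open>{0, \<dots>, L - 1}\<close>; the periodised weight depends
  only on the residue classes of \<open>x\<close> and \<open>y\<close>.\<close>

definition torus :: "nat \<Rightarrow> int set" where
  "torus L = {0..<int L}"

definition periodised :: "(int \<Rightarrow> real) \<Rightarrow> nat \<Rightarrow> int \<Rightarrow> int \<Rightarrow> real" where
  "periodised w L x y = (\<Sum>\<^sub>\<infinity>k\<in>UNIV. w (y - x + k * int L))"

definition torus_mdd :: "(int \<Rightarrow> real) \<Rightarrow> nat \<Rightarrow> int config measure" where
  "torus_mdd w L = mdd_measure (torus L) (periodised w L)"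

definition torus_loop :: "(int \<Rightarrow> real) \<Rightarrow> nat \<Rightarrow> int \<Rightarrow> int config \<Rightarrow> nat" where
  "torus_loop w L = loop_length (torus L) (periodised w L)"

definition torus_Lmax :: "(int \<Rightarrow> real) \<Rightarrow> nat \<Rightarrow> int config \<Rightarrow> nat" where
  "torus_Lmax w L = max_loop_length (torus L) (periodised w L)"

definition torus_M :: "(int \<Rightarrow> real) \<Rightarrow> nat \<Rightarrow> real" where
  "torus_M w L = (1 / real L) * (\<Sum>x\<in>torus L. mdd_G (torus L) (periodised w L) 0 x)"

abbreviation even_at_top :: "nat filter" where
  "even_at_top \<equiv> inf sequentially (principal {L. even L})"

end

theory Submission
  imports Defs
begin

text \<open>Group the configurations by their covered set \<open>U\<close>: writing \<open>D U\<close> for the weighted number of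
  perfect matchings of \<open>U\<close>, the law of \<open>U\<close> is proportional to \<open>nu U = a^|V - U| (D U)\<^sup>2\<close>. The
  two-point function is a sum over \<open>U\<close> of \<open>a^|V - U| D (U - {x, y}) D U\<close>. For loops, if \<open>x\<close> and
  \<open>y\<close> are of opposite colour and lie on the same loop, deleting the \<open>M2\<close>-edges \<open>{x, u}\<close> and \<open>{y, v}\<close>
  and swapping the two matchings on one of the resulting arcs turns \<open>(M1, M2)\<close> into perfect matchings
  of \<open>U - {x, y}\<close> and \<open>U - {u, v}\<close>. Both cases lead to overlaps of the form
  \<open>a^|V - U| D (U - S) D (U - T)\<close>.

  Let the charge of \<open>U\<close> in an arc be the number of its even minus the number of its odd points there.
  It is carried by the dimers crossing the ends of the arc, so the first moment condition bounds its
  variance uniformly in the length of the arc. By translation invariance, averages of the charge of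
  centred arcs at different dyadic scales are then almost uncorrelated, and averaging over \<open>J\<close> scales
  gives a function of \<open>U\<close> with second moment \<open>O(1/J)\<close> that still changes by \<open>1\<close> when \<open>x\<close>
  is removed. By the AM-GM inequality the overlaps are small unless \<open>y\<close> or \<open>v\<close> is close to \<open>x\<close>.\<close>

subsection \<open>Matchings and overlaps\<close>

text \<open>As \<open>nu\<close> is quadratic in \<open>D\<close>, an overlap is an inner product of
  two deletions of the same vector. If a function \<phi> of \<open>U\<close> has small second moment
  under \<open>nu\<close>, each factor is concentrated where \<phi> of its own argument is near 0;
  when the two arguments always have \<phi>-values at distance at least 1, the factors are hardly
  ever large together. The charge of one arc cannot serve as \<phi>: its variance is bounded but
  need not be small, so a shift by 1 may be within its typical fluctuation. Many arcs around
  \<open>x\<close> must be averaged, all of which feel the deletion of \<open>x\<close> by the same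
  amount. For two arcs with a common centre the covariance is a difference of two variances, so
  summing over one radius telescopes: boundedness of the variance becomes decay of the covariance
  between scales. The bound on the variance is itself an overlap estimate: one crossing dimer is
  deleted from each of the two matchings, and the crude bound without \<phi> is enough there. In the
  loop case \<open>u\<close> is joined to \<open>x\<close> by a positive weight and may well be
  close to it. Having the other colour, it reinforces the shift caused by \<open>x\<close> instead
  of cancelling it.\<close>

locale bipartite_mdd =
  fixes V :: "'a set" and W :: "'a \<Rightarrow> 'a \<Rightarrow> real" and a :: real and s :: "'a \<Rightarrow> bool"
  assumes finite_V: "finite V"
    and W_sym: "W x y = W y x"
    and W_nonneg: "W x y \<ge> 0"
    and W_diag: "x \<in> V \<Longrightarrow> W x x = a"
    and a_pos: "a > 0"
    and bipartite: "x \<in> V \<Longrightarrow> y \<in> V \<Longrightarrow> x \<noteq> y \<Longrightarrow> s x = s y \<Longrightarrow> W x y = 0"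
begin

abbreviation E :: "'a set set" where "E \<equiv> edges V W"

definition pm :: "'a set \<Rightarrow> 'a set set set" where
  "pm U = {M. M \<subseteq> E \<and> \<Union>M = U \<and> disjoint M}"

definition ew :: "'a set set \<Rightarrow> real" where
  "ew M = (\<Prod>e\<in>M. edge_weight W e)"

definition D :: "'a set \<Rightarrow> real" where
  "D U = (\<Sum>M\<in>pm U. ew M)"

definition nu :: "'a set \<Rightarrow> real" where
  "nu U = a ^ card (V - U) * (D U)\<^sup>2"

text \<open>An unnormalised expectation: its total mass is \<open>Z\<close>.\<close>

definition EE :: "('a set \<Rightarrow> real) \<Rightarrow> real" where
  "EE g = (\<Sum>U\<in>Pow V. nu U * g U)"

definition Z :: real where
  "Z = (\<Sum>U\<in>Pow V. nu U)"

lemma edge_weight_W: "edge_weight W {x, y} = W x y"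
  by (rule edge_weight_pair) (rule W_sym)

lemma edgeE:
  assumes "e \<in> E"
  obtains x y where "e = {x, y}" "x \<in> V" "y \<in> V" "x \<noteq> y" "s x" "\<not> s y" "W x y > 0"
proof -
  from assms obtain x y where *: "e = {x, y}" "x \<in> V" "y \<in> V" "x \<noteq> y" "W x y > 0"
    unfolding edges_def by auto
  with bipartite[of x y] have "s x \<noteq> s y" by auto
  then show thesis
    using * that[of x y] that[of y x] W_sym[of x y] by (cases "s x") (auto simp: insert_commute)
qed

lemma edgeE':
  assumes "e \<in> E" "x \<in> e"
  obtains y where "e = {x, y}" "x \<in> V" "y \<in> V" "x \<noteq> y" "s x \<noteq> s y" "W x y > 0"
proof -
  obtain p q where "e = {p, q}" "p \<in> V" "q \<in> V" "p \<noteq> q" "s p" "\<not> s q" "W p q > 0"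
    using assms(1) by (rule edgeE)
  then show thesis using assms(2) that[of p] that[of q] W_sym[of p q] by auto
qed

lemma pair_edgeD:
  assumes "{x, y} \<in> E"
  shows "x \<in> V" "y \<in> V" "x \<noteq> y" "s x \<noteq> s y" "W x y > 0"
  using edgeE'[OF assms, of x] by (auto simp: doubleton_eq_iff)

lemma edge_subset: "e \<in> E \<Longrightarrow> e \<subseteq> V"
  by (auto simp: edges_def)

lemma finite_edge: "e \<in> E \<Longrightarrow> finite e"
  by (auto simp: edges_def)

lemma card_edge: "e \<in> E \<Longrightarrow> card e = 2"
  by (auto simp: edges_def)

lemma edge_nonempty: "e \<in> E \<Longrightarrow> e \<noteq> {}"
  by (auto simp: edges_def)

lemma finite_E: "finite E"
  by (rule finite_subset[of _ "Pow V"]) (auto simp: finite_V dest: edge_subset)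

lemma edge_weight_pos: "e \<in> E \<Longrightarrow> edge_weight W e > 0"
  by (erule edgeE) (simp add: edge_weight_W)

lemma pmD:
  assumes "M \<in> pm U"
  shows "M \<subseteq> E" "\<Union>M = U" "finite M" "U \<subseteq> V" "finite U"
  using assms finite_subset[OF _ finite_E] edge_subset finite_subset[OF _ finite_V]
  unfolding pm_def by (auto, meson Sup_least finite_V finite_subset subsetD)

lemma pm_unique: "M \<in> pm U \<Longrightarrow> e \<in> M \<Longrightarrow> f \<in> M \<Longrightarrow> x \<in> e \<Longrightarrow> x \<in> f \<Longrightarrow> e = f"
  unfolding pm_def disjoint_def by blast

lemma pmI:
  assumes "M \<subseteq> E" "\<Union>M = U" "\<And>e f x. e \<in> M \<Longrightarrow> f \<in> M \<Longrightarrow> x \<in> e \<Longrightarrow> x \<in> f \<Longrightarrow> e = f"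
  shows "M \<in> pm U"
  using assms unfolding pm_def disjoint_def by blast

lemma finite_pm: "finite (pm U)"
  by (rule finite_subset[of _ "Pow E"]) (auto simp: finite_E dest: pmD)

lemma ew_pos: "M \<subseteq> E \<Longrightarrow> ew M > 0"
  unfolding ew_def by (rule prod_pos) (auto dest: edge_weight_pos)

lemma ew_nonneg: "M \<in> pm U \<Longrightarrow> ew M \<ge> 0"
  using ew_pos[of M] pmD(1) by fastforce

lemma D_nonneg: "D U \<ge> 0"
  unfolding D_def by (rule sum_nonneg) (rule ew_nonneg)

lemma nu_nonneg: "nu U \<ge> 0"
  unfolding nu_def using a_pos by simp

lemma pm_empty: "pm {} = {{}}"
proof -
  have "{} \<in> pm {}" by (rule pmI) auto
  moreover have "M = {}" if "M \<in> pm {}" for M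
  proof (rule ccontr)
    assume "M \<noteq> {}"
    then obtain e where "e \<in> M" by blast
    with pmD(1,2)[OF that] edge_nonempty[of e] show False by blast
  qed
  ultimately show ?thesis by blast
qed

lemma D_empty: "D {} = 1"
  by (simp add: D_def pm_empty ew_def)

lemma Z_pos: "Z > 0"
proof -
  have "0 < nu {}" unfolding nu_def by (simp add: D_empty a_pos)
  also have "\<dots> \<le> Z" unfolding Z_def
    by (rule member_le_sum) (auto simp: nu_nonneg finite_V)
  finally show ?thesis .
qed

lemma EE_nonneg: "(\<And>U. g U \<ge> 0) \<Longrightarrow> EE g \<ge> 0"
  unfolding EE_def by (intro sum_nonneg mult_nonneg_nonneg nu_nonneg)

lemma EE_add: "EE (\<lambda>U. f U + g U) = EE f + EE g"
  unfolding EE_def by (simp add: sum.distrib algebra_simps)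

lemma EE_diff: "EE (\<lambda>U. f U - g U) = EE f - EE g"
  unfolding EE_def by (simp add: sum_subtractf algebra_simps)

lemma EE_cmult: "EE (\<lambda>U. c * f U) = c * EE f"
  unfolding EE_def by (simp add: sum_distrib_left algebra_simps)

lemma EE_sum: "EE (\<lambda>U. \<Sum>i\<in>I. f i U) = (\<Sum>i\<in>I. EE (f i))"
  unfolding EE_def by (simp add: sum_distrib_left) (rule sum.swap)

text \<open>Reindex by \<open>U - S\<close>: the vertices of \<open>S\<close> turn into monomers,
  and the factor \<open>(1/a) ^ card S\<close> compensates for their weight. Only sets disjoint from
  \<open>S\<close> are reached, hence an inequality.\<close>

lemma sum_deleted_square:
  assumes S: "S \<subseteq> V" and g: "\<And>U. g U \<ge> 0"
  shows "(\<Sum>U\<in>{U. U \<subseteq> V \<and> S \<subseteq> U}. a ^ card (V - U) * (D (U - S))\<^sup>2 * g (U - S))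
    \<le> (1/a) ^ card S * EE g"
proof -
  let ?A = "{U. U \<subseteq> V \<and> S \<subseteq> U}"
  have inj: "inj_on (\<lambda>U. U - S) ?A" by (rule inj_onI) blast
  have eq: "a ^ card (V - U) = (1/a) ^ card S * a ^ card (V - (U - S))" if "U \<in> ?A" for U
  proof -
    have "V - (U - S) = (V - U) \<union> S" "(V - U) \<inter> S = {}" using that S by auto
    then have "card (V - (U - S)) = card (V - U) + card S"
      using finite_V S finite_subset by (metis card_Un_disjoint finite_Diff)
    then show ?thesis using a_pos by (simp add: power_add power_one_over)
  qed
  have "(\<Sum>U\<in>?A. a ^ card (V - U) * (D (U - S))\<^sup>2 * g (U - S))
      = (\<Sum>U\<in>?A. (1/a) ^ card S * (nu (U - S) * g (U - S)))"
    by (rule sum.cong) (auto simp: nu_def eq)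
  also have "\<dots> = (1/a) ^ card S * (\<Sum>U\<in>?A. nu (U - S) * g (U - S))"
    by (simp add: sum_distrib_left)
  also have "(\<Sum>U\<in>?A. nu (U - S) * g (U - S)) = (\<Sum>U\<in>(\<lambda>U. U - S) ` ?A. nu U * g U)"
    by (simp add: sum.reindex[OF inj])
  also have "\<dots> \<le> EE g" unfolding EE_def
    by (rule sum_mono2) (auto simp: finite_V g nu_nonneg)
  finally show ?thesis using a_pos by (simp add: mult_left_mono)
qed

definition overlap :: "'a set \<Rightarrow> 'a set \<Rightarrow> real" where
  "overlap S T = (\<Sum>U\<in>{U. U \<subseteq> V \<and> S \<subseteq> U \<and> T \<subseteq> U}.
     a ^ card (V - U) * D (U - S) * D (U - T))"

lemma overlap_nonneg: "overlap S T \<ge> 0"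
  unfolding overlap_def using a_pos by (intro sum_nonneg mult_nonneg_nonneg D_nonneg) auto

lemma EE_const: "EE (\<lambda>_. c) = c * Z"
  by (simp add: EE_def Z_def sum_distrib_left mult.commute)

text \<open>Each square on the right of \<open>le\<close> is weighted by \<open>g\<close> at its own
  argument, so the two halves can be reindexed separately by \<open>sum_deleted_square\<close>, each
  with its own deleted set.\<close>

lemma overlap_le_aux:
  assumes S: "S \<subseteq> V" and T: "T \<subseteq> V"
    and g: "\<And>U. g U \<ge> 0"
    and le: "\<And>U. S \<subseteq> U \<Longrightarrow> T \<subseteq> U \<Longrightarrow> U \<subseteq> V \<Longrightarrow>
        D (U - S) * D (U - T) \<le> g (U - S) * (D (U - S))\<^sup>2 + g (U - T) * (D (U - T))\<^sup>2"
  shows "overlap S T \<le> ((1/a) ^ card S + (1/a) ^ card T) * EE g"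
proof -
  let ?A = "{U. U \<subseteq> V \<and> S \<subseteq> U \<and> T \<subseteq> U}"
  have fin: "finite {U. U \<subseteq> V \<and> Q U}" for Q
    by (rule finite_subset[of _ "Pow V"]) (auto simp: finite_V)
  have "overlap S T \<le> (\<Sum>U\<in>?A. a ^ card (V - U) * (D (U - S))\<^sup>2 * g (U - S)
       + a ^ card (V - U) * (D (U - T))\<^sup>2 * g (U - T))"
    unfolding overlap_def
  proof (rule sum_mono)
    fix U assume "U \<in> ?A"
    then have "a ^ card (V - U) * (D (U - S) * D (U - T))
      \<le> a ^ card (V - U) * (g (U - S) * (D (U - S))\<^sup>2 + g (U - T) * (D (U - T))\<^sup>2)"
      using a_pos by (intro mult_left_mono le) auto
    then show "a ^ card (V - U) * D (U - S) * D (U - T)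
      \<le> a ^ card (V - U) * (D (U - S))\<^sup>2 * g (U - S) + a ^ card (V - U) * (D (U - T))\<^sup>2 * g (U - T)"
      by (simp add: algebra_simps)
  qed
  also have "\<dots> = (\<Sum>U\<in>?A. a ^ card (V - U) * (D (U - S))\<^sup>2 * g (U - S))
       + (\<Sum>U\<in>?A. a ^ card (V - U) * (D (U - T))\<^sup>2 * g (U - T))"
    by (rule sum.distrib)
  also have "\<dots> \<le> (\<Sum>U\<in>{U. U \<subseteq> V \<and> S \<subseteq> U}. a ^ card (V - U) * (D (U - S))\<^sup>2 * g (U - S))
       + (\<Sum>U\<in>{U. U \<subseteq> V \<and> T \<subseteq> U}. a ^ card (V - U) * (D (U - T))\<^sup>2 * g (U - T))"
    using a_pos g by (intro add_mono sum_mono2 fin) auto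
  also have "\<dots> \<le> (1/a) ^ card S * EE g + (1/a) ^ card T * EE g"
    by (intro add_mono sum_deleted_square S T g)
  finally show ?thesis by (simp add: algebra_simps)
qed

lemma overlap_le:
  assumes "S \<subseteq> V" "T \<subseteq> V"
  shows "overlap S T \<le> ((1/a) ^ card S + (1/a) ^ card T) / 2 * Z"
proof -
  have "overlap S T \<le> ((1/a) ^ card S + (1/a) ^ card T) * EE (\<lambda>_. 1/2)"
  proof (rule overlap_le_aux[OF assms])
    fix U
    have "0 \<le> (D (U - S) - D (U - T))\<^sup>2" by simp
    then show "D (U - S) * D (U - T) \<le> 1/2 * (D (U - S))\<^sup>2 + 1/2 * (D (U - T))\<^sup>2"
      by (simp add: power2_eq_square algebra_simps)
  qed auto
  then show ?thesis by (simp add: EE_const)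
qed

text \<open>Two deletions that change \<open>\<phi>\<close> by different amounts are nearly orthogonal as soon as
  \<open>\<phi>\<close> has small second moment.\<close>

lemma overlap_le_shift:
  assumes "S \<subseteq> V" "T \<subseteq> V" "t > 0"
    and sep: "\<And>U. S \<subseteq> U \<Longrightarrow> T \<subseteq> U \<Longrightarrow> U \<subseteq> V \<Longrightarrow> \<bar>\<phi> (U - S) - \<phi> (U - T)\<bar> \<ge> 1"
  shows "overlap S T \<le> ((1/a) ^ card S + (1/a) ^ card T) / 2 * (EE (\<lambda>U. (\<phi> U)\<^sup>2) / t + t * Z)"
proof -
  let ?g = "\<lambda>U. ((\<phi> U)\<^sup>2 / t + t) / 2"
  have amgm: "p * q * r \<le> (p\<^sup>2 / t * q\<^sup>2 + t * r\<^sup>2) / 2" for p q r :: real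
  proof -
    have "0 \<le> (p * q - t * r)\<^sup>2 / t" using \<open>t > 0\<close> by simp
    also have "\<dots> = p\<^sup>2 / t * q\<^sup>2 + t * r\<^sup>2 - 2 * (p * q * r)"
      using \<open>t > 0\<close> by (simp add: field_simps power2_eq_square)
    finally show ?thesis by simp
  qed
  have "overlap S T \<le> ((1/a) ^ card S + (1/a) ^ card T) * EE ?g"
  proof (rule overlap_le_aux[OF assms(1,2)])
    fix U assume U: "S \<subseteq> U" "T \<subseteq> U" "U \<subseteq> V"
    let ?p = "D (U - S)" and ?q = "D (U - T)" and ?f = "\<bar>\<phi> (U - S)\<bar>" and ?h = "\<bar>\<phi> (U - T)\<bar>"
    \<comment> \<open>At least one of the two values of \<phi> is of order 1, so the product may be
      multiplied by \<open>?f + ?h\<close>. The inequality \<open>amgm\<close> then keeps each value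
      of \<phi> with the factor that has the same argument.\<close>
    have "1 \<le> ?f + ?h" using sep[OF U] by linarith
    then have "1 * (?p * ?q) \<le> (?f + ?h) * (?p * ?q)"
      using D_nonneg by (intro mult_right_mono mult_nonneg_nonneg) auto
    also have "\<dots> = ?f * ?p * ?q + ?h * ?q * ?p" by (simp add: algebra_simps)
    also have "\<dots> \<le> (?f\<^sup>2 / t * ?p\<^sup>2 + t * ?q\<^sup>2) / 2 + (?h\<^sup>2 / t * ?q\<^sup>2 + t * ?p\<^sup>2) / 2"
      by (intro add_mono amgm)
    also have "\<dots> = ?g (U - S) * ?p\<^sup>2 + ?g (U - T) * ?q\<^sup>2"
      by (simp add: algebra_simps add_divide_distrib)
    finally show "?p * ?q \<le> ?g (U - S) * ?p\<^sup>2 + ?g (U - T) * ?q\<^sup>2" by simp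
  qed (use \<open>t > 0\<close> in auto)
  also have "EE ?g = EE (\<lambda>U. 1 / (2 * t) * (\<phi> U)\<^sup>2 + t / 2)"
    by (rule arg_cong[of _ _ EE]) (auto simp: fun_eq_iff field_simps)
  also have "\<dots> = (EE (\<lambda>U. (\<phi> U)\<^sup>2) / t + t * Z) / 2"
    unfolding EE_add EE_cmult EE_const using \<open>t > 0\<close> by (simp add: field_simps)
  finally show ?thesis by simp
qed

section \<open>The charge and its second moment\<close>

definition sg :: "'a \<Rightarrow> real" where "sg z = (if s z then 1 else -1)"

definition charge :: "('a \<Rightarrow> real) \<Rightarrow> 'a set \<Rightarrow> real" where
  "charge b U = (\<Sum>z\<in>U. sg z * b z)"

definition boundary :: "'a set \<Rightarrow> 'a set set" where
  "boundary I = {e \<in> E. e \<inter> I \<noteq> {} \<and> \<not> e \<subseteq> I}"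

lemma charge_pm:
  assumes "M \<in> pm U"
  shows "charge b U = (\<Sum>e\<in>M. \<Sum>z\<in>e. sg z * b z)"
proof -
  have "sum (\<lambda>z. sg z * b z) (\<Union>M) = (sum \<circ> sum) (\<lambda>z. sg z * b z) M"
    using pmD[OF assms] pm_unique[OF assms] finite_edge
    by (intro sum.Union_disjoint) blast+
  then show ?thesis using pmD(2)[OF assms] by (simp add: charge_def)
qed

text \<open>A dimer has one vertex of each colour, so a dimer inside \<open>I\<close> contributes
  \<open>1 - 1 = 0\<close>; only dimers cut by the boundary contribute, each with absolute value
  1.\<close>

lemma abs_charge_le:
  assumes "M \<in> pm U"
  shows "\<bar>charge (indicator I) U\<bar> \<le> real (card (M \<inter> boundary I))"
proof -
  have "\<bar>charge (indicator I) U\<bar> \<le> (\<Sum>e\<in>M. \<bar>\<Sum>z\<in>e. sg z * indicator I z\<bar>)"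
    unfolding charge_pm[OF assms] by (rule sum_abs)
  also have "\<dots> \<le> (\<Sum>e\<in>M. if e \<in> boundary I then 1 else 0)"
  proof (rule sum_mono)
    fix e assume "e \<in> M"
    then have e: "e \<in> E" using pmD(1)[OF assms] by blast
    then show "\<bar>\<Sum>z\<in>e. sg z * indicator I z\<bar> \<le> (if e \<in> boundary I then 1 else 0::real)"
      by (rule edgeE) (use e in \<open>auto simp: boundary_def sg_def indicator_def\<close>)
  qed
  also have "\<dots> = real (card (M \<inter> boundary I))"
    using pmD(3)[OF assms] by (simp add: sum.If_cases)
  finally show ?thesis .
qed

lemma pm_remove:
  assumes M: "M \<in> pm U" and "e \<in> M"
  shows "M - {e} \<in> pm (U - e)"
proof (rule pmI)
  show "M - {e} \<subseteq> E" using pmD(1)[OF M] by blast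
  show "\<Union> (M - {e}) = U - e" using pmD(2)[OF M] pm_unique[OF M] \<open>e \<in> M\<close> by blast
qed (use pm_unique[OF M] in blast)

lemma ew_remove:
  assumes M: "M \<in> pm U" and "e \<in> M"
  shows "ew M = edge_weight W e * ew (M - {e})"
  unfolding ew_def using prod.remove[OF pmD(3)[OF M] \<open>e \<in> M\<close>] by simp

lemma sum_pm_containing_le:
  assumes "e \<in> E" "e \<subseteq> U"
  shows "(\<Sum>M\<in>{M \<in> pm U. e \<in> M}. ew M) \<le> edge_weight W e * D (U - e)"
proof -
  have inj: "inj_on (\<lambda>M. M - {e}) {M \<in> pm U. e \<in> M}" by (rule inj_onI) blast
  have "(\<Sum>M\<in>{M \<in> pm U. e \<in> M}. ew M) = (\<Sum>M\<in>{M \<in> pm U. e \<in> M}. edge_weight W e * ew (M - {e}))"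
    by (rule sum.cong) (auto dest: ew_remove)
  also have "\<dots> = edge_weight W e * (\<Sum>M\<in>(\<lambda>M. M - {e}) ` {M \<in> pm U. e \<in> M}. ew M)"
    by (simp add: sum.reindex[OF inj] sum_distrib_left)
  also have "\<dots> \<le> edge_weight W e * D (U - e)"
    unfolding D_def using edge_weight_pos[OF assms(1)]
    by (intro mult_left_mono sum_mono2 finite_pm) (auto intro: pm_remove ew_nonneg)
  finally show ?thesis .
qed

text \<open>Mark a crossing dimer: a matching with \<open>k\<close> of them is counted
  \<open>k\<close> times in the sum over \<open>e\<close>, and deleting the marked one leaves a
  matching of \<open>U - e\<close>.\<close>

lemma abs_charge_D_le:
  "\<bar>charge (indicator I) U\<bar> * D U \<le> (\<Sum>e\<in>{e \<in> boundary I. e \<subseteq> U}. edge_weight W e * D (U - e))"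
proof -
  let ?B = "{e \<in> boundary I. e \<subseteq> U}"
  have finB: "finite ?B" using finite_E by (auto simp: boundary_def)
  have "\<bar>charge (indicator I) U\<bar> * D U = (\<Sum>M\<in>pm U. \<bar>charge (indicator I) U\<bar> * ew M)"
    by (simp add: D_def sum_distrib_left)
  also have "\<dots> \<le> (\<Sum>M\<in>pm U. \<Sum>e\<in>?B. if e \<in> M then ew M else 0)"
  proof (rule sum_mono)
    fix M assume M: "M \<in> pm U"
    have "M \<inter> boundary I = {e \<in> ?B. e \<in> M}" using pmD(2)[OF M] by auto
    then have "(\<Sum>e\<in>?B. if e \<in> M then ew M else 0) = real (card (M \<inter> boundary I)) * ew M"
      using finB by (simp add: sum.inter_filter[symmetric])
    then show "\<bar>charge (indicator I) U\<bar> * ew M \<le> (\<Sum>e\<in>?B. if e \<in> M then ew M else 0)"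
      using abs_charge_le[OF M] ew_nonneg[OF M] by (simp add: mult_right_mono)
  qed
  also have "\<dots> = (\<Sum>e\<in>?B. \<Sum>M\<in>{M \<in> pm U. e \<in> M}. ew M)"
    by (subst sum.swap) (simp add: sum.inter_filter[symmetric] finite_pm)
  also have "\<dots> \<le> (\<Sum>e\<in>?B. edge_weight W e * D (U - e))"
    by (rule sum_mono) (auto simp: boundary_def intro: sum_pm_containing_le)
  finally show ?thesis .
qed

lemma sum_indicator_mult:
  fixes f :: "'b \<Rightarrow> real"
  shows "finite A \<Longrightarrow> (\<Sum>x\<in>{x \<in> A. P x}. f x) = (\<Sum>x\<in>A. of_bool (P x) * f x)"
  by (subst sum.inter_filter, assumption, rule sum.cong) auto

text \<open>The two factors \<open>D U\<close> in \<open>nu U\<close> absorb one power of the charge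
  each. Squaring \<open>abs_charge_D_le\<close> thus marks a dimer \<open>e\<close> in one matching
  and \<open>f\<close> in the other, and the sum over \<open>U\<close> is the overlap of
  \<open>e\<close> and \<open>f\<close>.\<close>

lemma EE_charge_le:
  "EE (\<lambda>U. (charge (indicator I) U)\<^sup>2) \<le> ((\<Sum>e\<in>boundary I. edge_weight W e) / a)\<^sup>2 * Z"
proof -
  let ?B = "boundary I" and ?w = "edge_weight W"
  have finB: "finite ?B" using finite_E by (auto simp: boundary_def)
  have B: "e \<subseteq> V" "?w e \<ge> 0" "card e = 2" if "e \<in> ?B" for e
    using that edge_subset edge_weight_pos[of e] card_edge by (auto simp: boundary_def)
  have "EE (\<lambda>U. (charge (indicator I) U)\<^sup>2)
      = (\<Sum>U\<in>Pow V. a ^ card (V - U) * (\<bar>charge (indicator I) U\<bar> * D U)\<^sup>2)"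
    unfolding EE_def nu_def by (simp add: power_mult_distrib mult_ac)
  also have "\<dots> \<le> (\<Sum>U\<in>Pow V. a ^ card (V - U) * (\<Sum>e\<in>{e \<in> ?B. e \<subseteq> U}. ?w e * D (U - e))\<^sup>2)"
    using a_pos by (intro sum_mono mult_left_mono power_mono abs_charge_D_le mult_nonneg_nonneg D_nonneg) auto
  also have "\<dots> = (\<Sum>U\<in>Pow V. \<Sum>e\<in>?B. \<Sum>f\<in>?B. (of_bool (e \<subseteq> U \<and> f \<subseteq> U)) *
      (?w e * ?w f * (a ^ card (V - U) * D (U - e) * D (U - f))))"
  proof (rule sum.cong[OF refl])
    fix U
    have "a ^ card (V - U) * (\<Sum>e\<in>{e \<in> ?B. e \<subseteq> U}. ?w e * D (U - e))\<^sup>2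
      = a ^ card (V - U) * (\<Sum>e\<in>?B. \<Sum>f\<in>?B. (of_bool (e \<subseteq> U) * (?w e * D (U - e))) * (of_bool (f \<subseteq> U) * (?w f * D (U - f))))"
      unfolding sum_indicator_mult[OF finB] power2_eq_square sum_product ..
    then show "a ^ card (V - U) * (\<Sum>e\<in>{e \<in> ?B. e \<subseteq> U}. ?w e * D (U - e))\<^sup>2
      = (\<Sum>e\<in>?B. \<Sum>f\<in>?B. (of_bool (e \<subseteq> U \<and> f \<subseteq> U)) *
      (?w e * ?w f * (a ^ card (V - U) * D (U - e) * D (U - f))))"
      by (simp add: sum_distrib_left of_bool_conj mult_ac)
  qed
  also have "\<dots> = (\<Sum>e\<in>?B. \<Sum>f\<in>?B. \<Sum>U\<in>Pow V. (of_bool (e \<subseteq> U \<and> f \<subseteq> U)) *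
      (?w e * ?w f * (a ^ card (V - U) * D (U - e) * D (U - f))))"
    by (subst sum.swap, rule sum.cong[OF refl], rule sum.swap)
  also have "\<dots> = (\<Sum>e\<in>?B. \<Sum>f\<in>?B. ?w e * ?w f * overlap e f)"
  proof (intro sum.cong refl)
    fix e f
    have "(\<Sum>U\<in>Pow V. (of_bool (e \<subseteq> U \<and> f \<subseteq> U)) * (?w e * ?w f * (a ^ card (V - U) * D (U - e) * D (U - f))))
      = (\<Sum>U\<in>{U \<in> Pow V. e \<subseteq> U \<and> f \<subseteq> U}. ?w e * ?w f * (a ^ card (V - U) * D (U - e) * D (U - f)))"
      by (rule sum_indicator_mult[symmetric]) (simp add: finite_V)
    also have "\<dots> = ?w e * ?w f * overlap e f"
      unfolding overlap_def by (simp add: sum_distrib_left Pow_def conj_ac)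
    finally show "(\<Sum>U\<in>Pow V. (of_bool (e \<subseteq> U \<and> f \<subseteq> U)) * (?w e * ?w f * (a ^ card (V - U) * D (U - e) * D (U - f))))
      = ?w e * ?w f * overlap e f" .
  qed
  also have "\<dots> \<le> (\<Sum>e\<in>?B. \<Sum>f\<in>?B. ?w e * ?w f * ((1/a)\<^sup>2 * Z))"
  proof (intro sum_mono mult_left_mono mult_nonneg_nonneg)
    fix e f assume "e \<in> ?B" "f \<in> ?B"
    with overlap_le[of e f] B show "overlap e f \<le> (1/a)\<^sup>2 * Z" by simp
  qed (use B in auto)
  also have "\<dots> = ((\<Sum>e\<in>?B. ?w e) / a)\<^sup>2 * Z"
    unfolding sum_distrib_right[symmetric] sum_product[symmetric]
    by (simp add: power2_eq_square)
  finally show ?thesis .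
qed

lemma boundary_weight_le:
  assumes "I \<subseteq> V"
  shows "(\<Sum>e\<in>boundary I. edge_weight W e) \<le> (\<Sum>x\<in>I. \<Sum>y\<in>V - I. W x y)"
proof -
  have "(\<Sum>e\<in>boundary I. edge_weight W e) \<le> (\<Sum>(x, y)\<in>I \<times> (V - I). W x y)"
  proof (rule sum_le_included[where i = "\<lambda>(x, y). {x, y}"])
    show "\<forall>e\<in>boundary I. \<exists>p\<in>I \<times> (V - I). (\<lambda>(x, y). {x, y}) p = e \<and> edge_weight W e \<le> (\<lambda>(x, y). W x y) p"
    proof
      fix e assume e: "e \<in> boundary I"
      then obtain x y where "e = {x, y}" "x \<in> I" "y \<notin> I" "y \<in> V"
        unfolding boundary_def by (auto simp: edges_def)
      then show "\<exists>p\<in>I \<times> (V - I). (\<lambda>(x, y). {x, y}) p = e \<and> edge_weight W e \<le> (\<lambda>(x, y). W x y) p"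
        by (intro bexI[of _ "(x, y)"]) (auto simp: edge_weight_W)
    qed
  qed (use finite_E finite_V finite_subset[OF assms] W_nonneg in \<open>auto simp: boundary_def\<close>)
  then show ?thesis by (simp add: sum.cartesian_product)
qed

end

subsection \<open>Cutting loops\<close>

definition comp :: "'a set set \<Rightarrow> 'a \<Rightarrow> 'a set" where
  "comp M x = {y. (x, y) \<in> {(p, q). {p, q} \<in> M}\<^sup>*}"

lemma comp_self: "x \<in> comp M x"
  by (simp add: comp_def)

lemma comp_step: "y \<in> comp M x \<Longrightarrow> {y, z} \<in> M \<Longrightarrow> z \<in> comp M x"
  unfolding comp_def by (auto intro: rtrancl_into_rtrancl)

lemma comp_subset_closed:
  assumes "x \<in> Q" "\<And>p q. p \<in> Q \<Longrightarrow> {p, q} \<in> M \<Longrightarrow> q \<in> Q"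
  shows "comp M x \<subseteq> Q"
proof
  fix y assume "y \<in> comp M x"
  then have "(x, y) \<in> {(p, q). {p, q} \<in> M}\<^sup>*" by (simp add: comp_def)
  then show "y \<in> Q" by (induction rule: rtrancl_induct) (use assms in auto)
qed

text \<open>An edge counts as inside only if it lies entirely in \<open>P\<close>. Where this is
  applied no edge straddles \<open>P\<close>, because \<open>P\<close> is a connected
  component.\<close>

definition splice :: "'a set \<Rightarrow> 'a set set \<Rightarrow> 'a set set \<Rightarrow> 'a set set" where
  "splice P M N = {e \<in> M. e \<subseteq> P} \<union> {e \<in> N. \<not> e \<subseteq> P}"

context bipartite_mdd
begin

lemma comp_edge_cases:
  assumes "M \<subseteq> E" "e \<in> M"
  shows "e \<subseteq> comp M x \<or> e \<inter> comp M x = {}"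
proof -
  obtain p q where pq: "e = {p, q}" using assms edgeE by blast
  then have "{q, p} \<in> M" using assms by (simp add: insert_commute)
  then show ?thesis using comp_step[of p M x q] comp_step[of q M x p] pq assms(2) by auto
qed

lemma splice_pm:
  assumes M: "M \<in> pm U" and N: "N \<in> pm U'"
    and P: "\<And>e. e \<in> M \<union> N \<Longrightarrow> e \<subseteq> P \<or> e \<inter> P = {}"
  shows "splice P M N \<in> pm (U \<inter> P \<union> (U' - P))"
proof (rule pmI)
  show "splice P M N \<subseteq> E" using pmD(1)[OF M] pmD(1)[OF N] by (auto simp: splice_def)
  show "\<Union> (splice P M N) = U \<inter> P \<union> (U' - P)"
  proof
    show "\<Union> (splice P M N) \<subseteq> U \<inter> P \<union> (U' - P)"
      using pmD(2)[OF M] pmD(2)[OF N] P unfolding splice_def by blast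
    show "U \<inter> P \<union> (U' - P) \<subseteq> \<Union> (splice P M N)"
    proof
      fix z assume "z \<in> U \<inter> P \<union> (U' - P)"
      then consider "z \<in> U" "z \<in> P" | "z \<in> U'" "z \<notin> P" by blast
      then show "z \<in> \<Union> (splice P M N)"
      proof cases
        case 1
        then obtain e where "e \<in> M" "z \<in> e" using pmD(2)[OF M] by blast
        with 1 P[of e] show ?thesis unfolding splice_def by blast
      next
        case 2
        then obtain e where "e \<in> N" "z \<in> e" using pmD(2)[OF N] by blast
        with 2 show ?thesis unfolding splice_def by blast
      qed
    qed
  qed
  show "e = f" if "e \<in> splice P M N" "f \<in> splice P M N" "z \<in> e" "z \<in> f" for e f z
    using that pm_unique[OF M, of e f z] pm_unique[OF N, of e f z] P[of e] P[of f]
    unfolding splice_def by blast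
qed

lemma ew_splice:
  assumes M: "finite M" and N: "finite N"
  shows "ew (splice P M N) * ew (splice P N M) = ew M * ew N"
proof -
  let ?i = "\<lambda>M. {e \<in> M. e \<subseteq> P}" and ?o = "\<lambda>M. {e \<in> M. \<not> e \<subseteq> P}"
  have un: "ew (A \<union> B) = ew A * ew B" if "finite A" "finite B" "A \<inter> B = {}" for A B
    unfolding ew_def using that by (rule prod.union_disjoint)
  have "ew M = ew (?i M) * ew (?o M)" "ew N = ew (?i N) * ew (?o N)"
    by (subst un[symmetric]; use M N in \<open>auto intro!: arg_cong[of _ _ ew]\<close>)+
  moreover have "ew (splice P M N) = ew (?i M) * ew (?o N)" "ew (splice P N M) = ew (?i N) * ew (?o M)"
    unfolding splice_def by (rule un; use M N in auto)+
  ultimately show ?thesis by simp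
qed

lemma splice_Un: "splice P M N \<union> splice P N M = M \<union> N"
  by (auto simp: splice_def)

lemma splice_splice: "splice P (splice P M N) (splice P N M) = M"
  by (auto simp: splice_def)

text \<open>Orient the loop through \<open>x\<close> so that vertices of the colour of \<open>x\<close> are left along \<open>M1\<close>.
  The arc from \<open>x\<close> to the first visit of \<open>y\<close> is then one of the two pieces left when the
  \<open>M2\<close>-edges at \<open>x\<close> and \<open>y\<close> are removed.\<close>

lemma cut_loop:
  assumes M1: "M1 \<in> pm U" and M2: "M2 \<in> pm U"
    and conn: "y \<in> comp (M1 \<union> M2) x" and col: "s x \<noteq> s y"
    and xu: "{x, u} \<in> M2" and yv: "{y, v} \<in> M2" and xy: "{x, y} \<notin> M2"
  defines "P \<equiv> comp (M1 \<union> (M2 - {{x, u}, {y, v}})) x"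
  shows "y \<in> P" "u \<notin> P" "v \<notin> P"
proof -
  define p where "p = (\<lambda>(M :: 'a set set) z. SOME w. {z, w} \<in> M)"
  have p_eq: "p M z = w" if "M \<in> pm U" "{z, w} \<in> M" for M z w
  proof -
    have "{z, p M z} \<in> M" unfolding p_def using that(2) by (rule someI)
    with pm_unique[OF that(1) this that(2), of z] show ?thesis by (auto simp: doubleton_eq_iff)
  qed
  have p_edge: "{z, p M z} \<in> M" if M: "M \<in> pm U" and z: "z \<in> U" for M z
  proof -
    obtain e where "e \<in> M" "z \<in> e" using pmD(2)[OF M] z by blast
    moreover from this obtain w where "e = {z, w}" using pmD(1)[OF M] by (meson edgeE' subsetD)
    ultimately show ?thesis using p_eq[OF M, of z w] by simp
  qed
  \<comment> \<open>\<pi> walks around the loop: the colour of a vertex selects the matching to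
    follow, and colours alternate along edges. The identity outside \<open>U\<close> makes \<pi>
    injective on the whole type, so that \<open>funpow_inj_finite\<close> yields a period.\<close>
  define \<pi> where "\<pi> = (\<lambda>z. if z \<in> U then if s z = s x then p M1 z else p M2 z else z)"
  have vert: "z \<in> U" "w \<in> U" "s z \<noteq> s w" if "{z, w} \<in> M1 \<union> M2" for z w
    using that pmD(2)[OF M1] pmD(2)[OF M2] pmD(1)[OF M1] pmD(1)[OF M2] pair_edgeD(4)[of z w] by auto
  have pi1: "\<pi> z = w" if "{z, w} \<in> M1" "s z = s x" for z w
    using that vert[of z w] p_eq[OF M1 that(1)] by (simp add: \<pi>_def)
  have pi2: "\<pi> z = w" if "{z, w} \<in> M2" "s z \<noteq> s x" for z w
    using that vert[of z w] p_eq[OF M2 that(1)] by (simp add: \<pi>_def)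
  have nbr: "\<pi> z = w \<or> \<pi> w = z" if "{z, w} \<in> M1 \<union> M2" for z w
    using that pi1[of z w] pi1[of w z] pi2[of z w] pi2[of w z] vert(3)[OF that]
    by (cases "s z = s x") (auto simp: insert_commute)
  have pi_edge: "{z, \<pi> z} \<in> (if s z = s x then M1 else M2)" if "z \<in> U" for z
    using that p_edge[OF M1] p_edge[OF M2] by (simp add: \<pi>_def)
  have pi_U: "\<pi> z \<in> U" and pi_col: "s (\<pi> z) \<noteq> s z" if "z \<in> U" for z
    using vert[of z "\<pi> z"] pi_edge[OF that] by (auto split: if_splits)
  have "inj \<pi>"
  proof (rule injI)
    fix z z' assume eq: "\<pi> z = \<pi> z'"
    show "z = z'"
    proof (cases "z \<in> U \<and> z' \<in> U")
      case True
      then have "s z = s z'" using pi_col[of z] pi_col[of z'] eq by auto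
      then have "{z, \<pi> z} = {z', \<pi> z}"
        using True pi_edge[of z] pi_edge[of z'] eq pm_unique[OF M1, of _ _ "\<pi> z"] pm_unique[OF M2, of _ _ "\<pi> z"]
        by (auto split: if_splits)
      then show ?thesis by (auto simp: doubleton_eq_iff)
    next
      case False
      then show ?thesis using pi_U[of z] pi_U[of z'] eq by (auto simp: \<pi>_def split: if_splits)
    qed
  qed
  have xU: "x \<in> U" and yU: "y \<in> U" using vert xu yv by blast+
  have iter_U: "(\<pi> ^^ i) x \<in> U" for i by (induction i) (use xU pi_U in auto)
  have pred: "\<exists>i. w = (\<pi> ^^ i) x \<and> k = Suc i"
    if "\<pi> w = (\<pi> ^^ k) x" "k > 0" for w k
  proof -
    obtain i where "k = Suc i" using \<open>k > 0\<close> by (cases k) auto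
    with that \<open>inj \<pi>\<close> show ?thesis by (auto dest: injD)
  qed
  have "finite {z. \<exists>n. z = (\<pi> ^^ n) x}"
    by (rule finite_subset[OF _ pmD(5)[OF M1]]) (use iter_U in auto)
  with \<open>inj \<pi>\<close> obtain n where n: "n > 0" "(\<pi> ^^ n) x = x" by (rule funpow_inj_finite)
  have "comp (M1 \<union> M2) x \<subseteq> range (\<lambda>i. (\<pi> ^^ i) x)"
  proof (rule comp_subset_closed)
    show "x \<in> range (\<lambda>i. (\<pi> ^^ i) x)" by (rule image_eqI[of _ _ 0]) auto
    fix z w assume "z \<in> range (\<lambda>i. (\<pi> ^^ i) x)" and zw: "{z, w} \<in> M1 \<union> M2"
    then obtain i where i: "z = (\<pi> ^^ i) x" by blast
    have "\<pi> z = w \<or> \<pi> w = z"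
      by (rule nbr[OF zw])
    then show "w \<in> range (\<lambda>i. (\<pi> ^^ i) x)"
    proof
      assume "\<pi> z = w"
      then have "w = (\<pi> ^^ Suc i) x" using i by simp
      then show ?thesis by blast
    next
      assume "\<pi> w = z"
      \<comment> \<open>To step backwards from \<open>x\<close> itself, use that \<open>x\<close> is
        also the \<open>n\<close>-th iterate; \<open>pred\<close> asks for a positive
        exponent.\<close>
      moreover have "z = (\<pi> ^^ (if i = 0 then n else i)) x" using i n by simp
      moreover have "0 < (if i = 0 then n else i)" using n(1) by simp
      ultimately have "\<exists>k. w = (\<pi> ^^ k) x" using pred[of w "if i = 0 then n else i"] by blast
      then show ?thesis by blast
    qed
  qed
  with conn have "\<exists>j. y = (\<pi> ^^ j) x" by blast
  then obtain j where j: "y = (\<pi> ^^ j) x" and min: "\<And>i. i < j \<Longrightarrow> y \<noteq> (\<pi> ^^ i) x"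
    using exists_least_iff[of "\<lambda>j. y = (\<pi> ^^ j) x"] by blast
  have noret: "(\<pi> ^^ i) x \<noteq> x" if "0 < i" "i \<le> j" for i
  proof
    assume eq: "(\<pi> ^^ i) x = x"
    have "y = (\<pi> ^^ (j - i + i)) x" using j that by simp
    also have "\<dots> = (\<pi> ^^ (j - i)) x" unfolding funpow_add by (simp add: eq)
    finally show False using min[of "j - i"] that by simp
  qed
  define Q where "Q = (\<lambda>i. (\<pi> ^^ i) x) ` {..j}"
  let ?N = "M1 \<union> (M2 - {{x, u}, {y, v}})"
  have ux: "{u, x} \<in> M2" using xu by (simp add: insert_commute)
  have su: "s u \<noteq> s x" and sv: "s v \<noteq> s y" using vert(3)[of x u] vert(3)[of y v] xu yv by auto
  \<comment> \<open>The deleted edges are the step into \<open>x\<close> and the step out of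
    \<open>y\<close>. The latter is an \<open>M2\<close>-step since \<open>y\<close> has the other
    colour, so the walk from \<open>x\<close> to \<open>y\<close> uses neither of them.\<close>
  have pi_u: "\<pi> u = x" by (rule pi2[OF ux su])
  have pi_y: "\<pi> y = v" using pi2[OF yv] col by auto
  have uy: "u \<noteq> y" using xy xu by auto
  have vx: "v \<noteq> x" using xy yv by (auto simp: insert_commute)
  have "P \<subseteq> Q" unfolding P_def
  proof (rule comp_subset_closed)
    show "x \<in> Q" unfolding Q_def by (rule image_eqI[of _ _ 0]) auto
    fix z w assume "z \<in> Q" and zw: "{z, w} \<in> ?N"
    then obtain i where i: "z = (\<pi> ^^ i) x" "i \<le> j" unfolding Q_def by blast
    have "\<pi> z = w \<or> \<pi> w = z"
      using nbr[of z w] zw by blast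
    then show "w \<in> Q"
    proof
      assume zw': "\<pi> z = w"
      \<comment> \<open>Although deleted from \<open>M2\<close>, the edge \<open>{y, v}\<close>
        could survive in \<open>M1\<close>. The walk would then go back and forth between
        \<open>y\<close> and \<open>v\<close>, so \<open>y\<close> would have been visited before
        time \<open>j\<close>.\<close>
      have "i \<noteq> j"
      proof
        assume "i = j"
        then have "z = y" "w = v" using i j zw' pi_y by auto
        with zw have "{y, v} \<in> M1" by auto
        then have "\<pi> v = y" using pi1[of v y] sv col by (auto simp: insert_commute)
        moreover have "j > 0" using j col by (cases j) auto
        ultimately obtain i' where i': "v = (\<pi> ^^ i') x" "j = Suc i'" using pred[of v j] j by auto
        moreover have "i' > 0" using i' vx by (cases i') auto
        ultimately obtain i'' where "y = (\<pi> ^^ i'') x" "i' = Suc i''" using pred[of y i'] pi_y by auto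
        then show False using min[of i''] i' by simp
      qed
      then have "Suc i \<le> j" "w = (\<pi> ^^ Suc i) x" using i zw' by auto
      then show ?thesis unfolding Q_def by blast
    next
      assume wz': "\<pi> w = z"
      show ?thesis
      proof (cases "i = 0")
        \<comment> \<open>Stepping back from \<open>x\<close> leads to \<open>u\<close>, which is
          possible only if \<open>{x, u}\<close> also lies in \<open>M1\<close>. Then the walk
          closes up after two steps, without ever meeting \<open>y\<close>.\<close>
        case True
        then have "w = u" using i wz' pi_u \<open>inj \<pi>\<close> by (auto dest: injD)
        then have "{x, u} \<in> M1" using True i zw by auto
        then have px: "\<pi> x = u" by (rule pi1) simp
        then have "(\<pi> ^^ 2) x = x" using pi_u by (simp add: numeral_2_eq_2)
        then have "j < 2" using noret[of 2] by force
        then have "y = x \<or> y = u" using j px by (auto simp: numeral_2_eq_2 less_Suc_eq)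
        then show ?thesis using col uy by auto
      next
        case False
        then obtain i' where "w = (\<pi> ^^ i') x" "i = Suc i'" using pred[of w i] wz' i by auto
        then show ?thesis using i unfolding Q_def by auto
      qed
    qed
  qed
  show "u \<notin> P"
  proof
    assume "u \<in> P"
    then obtain i where i: "u = (\<pi> ^^ i) x" "i \<le> j" using \<open>P \<subseteq> Q\<close> unfolding Q_def by blast
    then have "(\<pi> ^^ Suc i) x = x" using pi_u by simp
    moreover have "i \<noteq> j" using i j uy by auto
    ultimately show False using noret[of "Suc i"] i by simp
  qed
  show "v \<notin> P"
  proof
    assume "v \<in> P"
    then obtain i where i: "v = (\<pi> ^^ i) x" "i \<le> j" using \<open>P \<subseteq> Q\<close> unfolding Q_def by blast
    then have "i > 0" using vx by (cases i) auto
    with i pi_y pred[of y i] obtain i' where "y = (\<pi> ^^ i') x" "i = Suc i'" by auto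
    then show False using min[of i'] i by simp
  qed
  have "(\<pi> ^^ i) x \<in> P" if "i \<le> j" for i
    using that
  proof (induction i)
    case 0
    show ?case by (simp add: P_def comp_self)
  next
    case (Suc i)
    let ?z = "(\<pi> ^^ i) x"
    have nx: "\<pi> ?z \<noteq> x" using noret[of "Suc i"] Suc.prems by simp
    have ny: "?z \<noteq> y" using min[of i] Suc.prems by auto
    \<comment> \<open>An \<open>M2\<close>-step starts at the colour of \<open>y\<close> and ends at
      the colour of \<open>x\<close>. Before time \<open>j\<close> it neither starts at
      \<open>y\<close> nor ends at \<open>x\<close>, so it avoids both vertices and hence both
      deleted edges.\<close>
    have "{?z, \<pi> ?z} \<in> ?N"
    proof (cases "s ?z = s x")
      case True
      then show ?thesis using pi_edge[OF iter_U[of i]] by simp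
    next
      case False
      then have "?z \<noteq> x" "{?z, \<pi> ?z} \<in> M2" using pi_edge[OF iter_U[of i]] by auto
      moreover have "s (\<pi> ?z) \<noteq> s y" using pi_col[OF iter_U[of i]] False col by auto
      ultimately show ?thesis using nx ny by (auto simp: doubleton_eq_iff)
    qed
    then show ?case using Suc comp_step[of ?z ?N x "\<pi> ?z"] by (simp add: P_def)
  qed
  then show "y \<in> P" using j by simp
qed

text \<open>If \<open>{x, y}\<close> were an edge of \<open>M2\<close>, the two edges to be cut
  would coincide. Such pairs are few and are counted separately in
  \<open>card_bichrom_edges_le\<close>.\<close>

definition loop_pairs :: "'a set \<Rightarrow> 'a \<Rightarrow> 'a \<Rightarrow> ('a set set \<times> 'a set set) set" where
  "loop_pairs U x y = {(M1, M2) \<in> pm U \<times> pm U. y \<in> comp (M1 \<union> M2) x \<and> {x, y} \<notin> M2}"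

definition cuts :: "'a \<Rightarrow> 'a \<Rightarrow> ('a \<times> 'a) set" where
  "cuts x y = {(u, v) \<in> V \<times> V. s u \<noteq> s x \<and> s v \<noteq> s y \<and> u \<noteq> y \<and> v \<noteq> x}"

lemma finite_cuts: "finite (cuts x y)"
  by (rule finite_subset[of _ "V \<times> V"]) (auto simp: cuts_def finite_V)

lemma comp_endpoint:
  assumes "M \<subseteq> E" "y \<in> comp M x" "y \<noteq> x"
  shows "x \<in> \<Union>M" "y \<in> \<Union>M"
proof -
  have xy: "(x, y) \<in> {(p, q). {p, q} \<in> M}\<^sup>*" using assms(2) by (simp add: comp_def)
  show "y \<in> \<Union>M" using xy assms(3) by (cases rule: rtranclE) auto
  show "x \<in> \<Union>M" using xy assms(3) by (cases rule: converse_rtranclE) auto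
qed

text \<open>Let \<open>P\<close> be the arc containing \<open>x\<close> and \<open>y\<close>, and
  \<open>M'\<close> the matching \<open>M2\<close> without the cut edges. Inside \<open>P\<close>,
  \<open>M'\<close> misses \<open>x\<close> and \<open>y\<close>; outside, it misses
  \<open>u\<close> and \<open>v\<close>; \<open>M1\<close> misses nothing. Exchanging
  \<open>M1\<close> and \<open>M'\<close> inside \<open>P\<close> therefore gives one defect pair to
  each new matching. The exchange preserves the union of the edges, so \<open>P\<close> is still the
  component of \<open>x\<close> in \<open>N1 \<union> N2\<close>, and the original pair can be
  recovered from \<open>u\<close>, \<open>v\<close>, \<open>N1\<close>, \<open>N2\<close>.\<close>

lemma surgery:
  assumes col: "s x \<noteq> s y" and M: "(M1, M2) \<in> loop_pairs U x y"
  obtains u v N1 N2 where "(u, v) \<in> cuts x y" "{x, y, u, v} \<subseteq> U"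
    "N1 \<in> pm (U - {x, y})" "N2 \<in> pm (U - {u, v})"
    "ew M1 * ew M2 = W x u * W y v * ew N1 * ew N2"
    "M1 = splice (comp (N1 \<union> N2) x) N2 N1"
    "M2 = insert {x, u} (insert {y, v} (splice (comp (N1 \<union> N2) x) N1 N2))"
proof -
  have M1: "M1 \<in> pm U" and M2: "M2 \<in> pm U" and conn: "y \<in> comp (M1 \<union> M2) x"
    and xy: "{x, y} \<notin> M2"
    using M by (auto simp: loop_pairs_def)
  have "M1 \<union> M2 \<subseteq> E" using pmD(1)[OF M1] pmD(1)[OF M2] by blast
  with comp_endpoint[OF this conn] col have U: "x \<in> U" "y \<in> U"
    using pmD(2)[OF M1] pmD(2)[OF M2] by auto
  have ex: "\<exists>w. {z, w} \<in> M2" if "z \<in> U" for z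
  proof -
    obtain e where "e \<in> M2" "z \<in> e" using pmD(2)[OF M2] \<open>z \<in> U\<close> by blast
    then show ?thesis using pmD(1)[OF M2] by (metis edgeE' subsetD)
  qed
  obtain u v where xu: "{x, u} \<in> M2" and yv: "{y, v} \<in> M2" using ex U by blast
  define M' where "M' = M2 - {{x, u}, {y, v}}"
  define P where "P = comp (M1 \<union> M') x"
  have P: "x \<in> P" "y \<in> P" "u \<notin> P" "v \<notin> P"
    using cut_loop[OF M1 M2 conn col xu yv xy] by (auto simp: P_def M'_def comp_self)
  have xuE: "{x, u} \<in> E" and yvE: "{y, v} \<in> E" using xu yv pmD(1)[OF M2] by auto
  have uv: "u \<in> U" "v \<in> U" using xu yv pmD(2)[OF M2] by auto
  have uy: "u \<noteq> y" and vx: "v \<noteq> x" using xu yv xy by (auto simp: insert_commute)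
  have ne: "{x, u} \<noteq> {y, v}" using P uy col by (auto simp: doubleton_eq_iff)
  have M'_eq: "M' = M2 - {{x, u}} - {{y, v}}" by (auto simp: M'_def)
  have M'pm: "M' \<in> pm (U - {x, u} - {y, v})"
    unfolding M'_eq by (intro pm_remove M2 xu) (use ne yv in auto)
  have ewM2: "ew M2 = W x u * W y v * ew M'"
    using ew_remove[OF M2 xu] ew_remove[OF pm_remove[OF M2 xu], of "{y, v}"] ne yv
    by (simp add: M'_eq edge_weight_W)
  have closed: "e \<subseteq> P \<or> e \<inter> P = {}" if "e \<in> M1 \<union> M'" for e
    unfolding P_def using that pmD(1)[OF M1] pmD(1)[OF M'pm] by (intro comp_edge_cases) auto
  define N1 where "N1 = splice P M' M1"
  define N2 where "N2 = splice P M1 M'"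
  have "N1 \<in> pm ((U - {x, u} - {y, v}) \<inter> P \<union> (U - P))"
    unfolding N1_def by (rule splice_pm[OF M'pm M1]) (use closed in blast)
  also have "(U - {x, u} - {y, v}) \<inter> P \<union> (U - P) = U - {x, y}" using P by blast
  finally have N1: "N1 \<in> pm (U - {x, y})" .
  have "N2 \<in> pm (U \<inter> P \<union> ((U - {x, u} - {y, v}) - P))"
    unfolding N2_def by (rule splice_pm[OF M1 M'pm]) (use closed in blast)
  also have "U \<inter> P \<union> ((U - {x, u} - {y, v}) - P) = U - {u, v}" using P by blast
  finally have N2: "N2 \<in> pm (U - {u, v})" .
  have NP: "comp (N1 \<union> N2) x = P"
    unfolding N1_def N2_def splice_Un P_def by (simp add: Un_commute)
  have "(u, v) \<in> cuts x y"
    using pair_edgeD[OF xuE] pair_edgeD[OF yvE] uy vx by (auto simp: cuts_def)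
  moreover have "ew M1 * ew M2 = W x u * W y v * ew N1 * ew N2"
    using ew_splice[OF pmD(3)[OF M'pm] pmD(3)[OF M1], of P] ewM2 by (simp add: N1_def N2_def)
  moreover have "M1 = splice (comp (N1 \<union> N2) x) N2 N1"
    unfolding NP unfolding N1_def N2_def by (rule splice_splice[symmetric])
  moreover have "M2 = insert {x, u} (insert {y, v} (splice (comp (N1 \<union> N2) x) N1 N2))"
    unfolding NP unfolding N1_def N2_def splice_splice M'_def using xu yv by auto
  ultimately show thesis using that[of u v N1 N2] N1 N2 U uv by simp
qed

text \<open>The surgery is read backwards: the reconstruction map, defined on all choices of
  \<open>u\<close>, \<open>v\<close>, \<open>N1\<close>, \<open>N2\<close>, reaches every loop pair
  from a choice of the same weight.\<close>

lemma loop_pairs_weight_le: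
  assumes col: "s x \<noteq> s y"
  shows "(\<Sum>(M1, M2)\<in>loop_pairs U x y. ew M1 * ew M2)
    \<le> (\<Sum>(u, v)\<in>{(u, v) \<in> cuts x y. {x, y, u, v} \<subseteq> U}. W x u * W y v * (D (U - {x, y}) * D (U - {u, v})))"
proof -
  let ?T = "{(u, v) \<in> cuts x y. {x, y, u, v} \<subseteq> U}"
  let ?S = "SIGMA p:?T. pm (U - {x, y}) \<times> pm (U - {fst p, snd p})"
  let ?i = "\<lambda>((u, v), N1, N2). (splice (comp (N1 \<union> N2) x) N2 N1,
     insert {x, u} (insert {y, v} (splice (comp (N1 \<union> N2) x) N1 N2)))"
  let ?g = "\<lambda>((u, v), N1, N2). W x u * W y v * (ew N1 * ew N2)"
  have finT: "finite ?T" by (rule finite_subset[OF _ finite_cuts[of x y]]) auto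
  have "(\<Sum>(M1, M2)\<in>loop_pairs U x y. ew M1 * ew M2) \<le> (\<Sum>q\<in>?S. ?g q)"
  proof (rule sum_le_included[where i = ?i])
    show "finite (loop_pairs U x y)"
      by (rule finite_subset[of _ "pm U \<times> pm U"]) (auto simp: loop_pairs_def finite_pm)
    show "finite ?S" using finT finite_pm by auto
    show "\<forall>q\<in>?S. 0 \<le> ?g q" by (auto intro!: mult_nonneg_nonneg W_nonneg ew_nonneg)
    show "\<forall>m\<in>loop_pairs U x y. \<exists>q\<in>?S. ?i q = m \<and> (case m of (M1, M2) \<Rightarrow> ew M1 * ew M2) \<le> ?g q"
    proof
      fix m assume "m \<in> loop_pairs U x y"
      moreover obtain M1 M2 where m: "m = (M1, M2)" by fastforce
      ultimately have "(M1, M2) \<in> loop_pairs U x y" by simp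
      then obtain u v N1 N2 where *: "(u, v) \<in> cuts x y" "{x, y, u, v} \<subseteq> U"
        "N1 \<in> pm (U - {x, y})" "N2 \<in> pm (U - {u, v})"
        "ew M1 * ew M2 = W x u * W y v * ew N1 * ew N2"
        "M1 = splice (comp (N1 \<union> N2) x) N2 N1"
        "M2 = insert {x, u} (insert {y, v} (splice (comp (N1 \<union> N2) x) N1 N2))"
        by (rule surgery[OF col])
      have "((u, v), N1, N2) \<in> ?S" using *(1-4) by auto
      moreover have "?i ((u, v), N1, N2) = m" using *(6,7) m by simp
      moreover have "(case m of (M1, M2) \<Rightarrow> ew M1 * ew M2) \<le> ?g ((u, v), N1, N2)"
        using *(5) m by simp
      ultimately show "\<exists>q\<in>?S. ?i q = m \<and> (case m of (M1, M2) \<Rightarrow> ew M1 * ew M2) \<le> ?g q" by blast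
    qed
  qed
  also have "\<dots> = (\<Sum>p\<in>?T. \<Sum>n\<in>pm (U - {x, y}) \<times> pm (U - {fst p, snd p}). ?g (p, n))"
    using finT finite_pm by (subst sum.Sigma) auto
  also have "\<dots> = (\<Sum>(u, v)\<in>?T. W x u * W y v * (D (U - {x, y}) * D (U - {u, v})))"
  proof (rule sum.cong[OF refl])
    fix p assume "p \<in> ?T"
    obtain u v where p: "p = (u, v)" by fastforce
    have "(\<Sum>n\<in>pm (U - {x, y}) \<times> pm (U - {u, v}). ?g ((u, v), n))
      = (\<Sum>N1\<in>pm (U - {x, y}). \<Sum>N2\<in>pm (U - {u, v}). W x u * W y v * (ew N1 * ew N2))"
      by (simp add: sum.cartesian_product)
    also have "\<dots> = W x u * W y v * (D (U - {x, y}) * D (U - {u, v}))"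
      unfolding D_def sum_product by (simp add: sum_distrib_left)
    finally show "(\<Sum>n\<in>pm (U - {x, y}) \<times> pm (U - {fst p, snd p}). ?g (p, n))
      = (case p of (u, v) \<Rightarrow> W x u * W y v * (D (U - {x, y}) * D (U - {u, v})))"
      by (simp add: p)
  qed
  finally show ?thesis .
qed

lemma loop_pairs_total_le:
  assumes col: "s x \<noteq> s y"
  shows "(\<Sum>U\<in>Pow V. a ^ card (V - U) * (\<Sum>(M1, M2)\<in>loop_pairs U x y. ew M1 * ew M2))
    \<le> (\<Sum>(u, v)\<in>cuts x y. W x u * W y v * overlap {x, y} {u, v})"
proof -
  let ?d = "\<lambda>U p. a ^ card (V - U) * D (U - {x, y}) * D (U - {fst p, snd p})"
  have "(\<Sum>U\<in>Pow V. a ^ card (V - U) * (\<Sum>(M1, M2)\<in>loop_pairs U x y. ew M1 * ew M2))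
    \<le> (\<Sum>U\<in>Pow V. a ^ card (V - U) * (\<Sum>p\<in>{p \<in> cuts x y. {x, y, fst p, snd p} \<subseteq> U}.
         W x (fst p) * W y (snd p) * (D (U - {x, y}) * D (U - {fst p, snd p}))))"
    using a_pos loop_pairs_weight_le[OF col]
    by (intro sum_mono mult_left_mono) (auto simp: case_prod_unfold)
  also have "\<dots> = (\<Sum>U\<in>Pow V. \<Sum>p\<in>cuts x y. of_bool ({x, y, fst p, snd p} \<subseteq> U) *
      (W x (fst p) * W y (snd p) * ?d U p))"
    unfolding sum_indicator_mult[OF finite_cuts] sum_distrib_left
    by (intro sum.cong refl) (simp add: mult_ac)
  also have "\<dots> = (\<Sum>p\<in>cuts x y. \<Sum>U\<in>Pow V. of_bool ({x, y, fst p, snd p} \<subseteq> U) *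
      (W x (fst p) * W y (snd p) * ?d U p))"
    by (rule sum.swap)
  also have "\<dots> = (\<Sum>p\<in>cuts x y. W x (fst p) * W y (snd p) * overlap {x, y} {fst p, snd p})"
  proof (rule sum.cong[OF refl])
    fix p
    have "(\<Sum>U\<in>Pow V. of_bool ({x, y, fst p, snd p} \<subseteq> U) * (W x (fst p) * W y (snd p) * ?d U p))
      = (\<Sum>U\<in>{U \<in> Pow V. {x, y, fst p, snd p} \<subseteq> U}. W x (fst p) * W y (snd p) * ?d U p)"
      by (rule sum_indicator_mult[symmetric]) (simp add: finite_V)
    also have "{U \<in> Pow V. {x, y, fst p, snd p} \<subseteq> U} = {U. U \<subseteq> V \<and> {x, y} \<subseteq> U \<and> {fst p, snd p} \<subseteq> U}"
      by auto
    finally show "(\<Sum>U\<in>Pow V. of_bool ({x, y, fst p, snd p} \<subseteq> U) * (W x (fst p) * W y (snd p) * ?d U p))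
      = W x (fst p) * W y (snd p) * overlap {x, y} {fst p, snd p}"
      unfolding overlap_def sum_distrib_left .
  qed
  finally show ?thesis by (simp add: case_prod_unfold)
qed

end

subsection \<open>Configurations as pairs of matchings\<close>

lemma comp_sym:
  assumes "y \<in> comp M x"
  shows "x \<in> comp M y"
proof -
  have "sym {(p, q). {p, q} \<in> M}" by (auto simp: sym_def insert_commute)
  then show ?thesis using assms sym_rtrancl unfolding comp_def by (auto dest: symD)
qed

lemma comp_trans: "y \<in> comp M x \<Longrightarrow> z \<in> comp M y \<Longrightarrow> z \<in> comp M x"
  unfolding comp_def by (auto intro: rtrancl_trans)

context bipartite_mdd
begin

text \<open>The restriction to \<open>E\<close> yields the value \<open>undefined\<close> elsewhere,
  as membership in the extensional function space \<open>dimers V W\<close> requires.\<close>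

definition ind :: "'a set set \<Rightarrow> 'a set \<Rightarrow> nat" where
  "ind M = (\<lambda>e\<in>E. of_bool (e \<in> M))"

lemma ind_dimers: "ind M \<in> dimers V W"
  by (auto simp: ind_def dimers_def)

lemma ind_inj: "M \<subseteq> E \<Longrightarrow> N \<subseteq> E \<Longrightarrow> ind M = ind N \<Longrightarrow> M = N"
  unfolding ind_def by (auto simp: fun_eq_iff restrict_def subset_iff) (metis of_bool_eq_iff)+

lemma dimers_ind:
  assumes "m \<in> dimers V W"
  obtains M where "M \<subseteq> E" "m = ind M"
proof
  show "{e \<in> E. m e = 1} \<subseteq> E" by auto
  show "m = ind {e \<in> E. m e = 1}"
    using assms by (auto simp: ind_def dimers_def fun_eq_iff PiE_iff extensional_def)
qed

lemma finite_edges_at: "finite {y. {x, y} \<in> E}"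
  by (rule finite_subset[OF _ finite_V]) (auto dest: pair_edgeD)

lemma occ_ind:
  assumes "M \<subseteq> E"
  shows "occ V W (ind M) x = card {e \<in> M. x \<in> e}"
proof -
  have "occ V W (ind M) x = (\<Sum>y\<in>{y. {x, y} \<in> E}. if {x, y} \<in> M then 1 else 0)"
    unfolding occ_def by (rule sum.cong) (auto simp: ind_def)
  also have "\<dots> = card {y. {x, y} \<in> M}"
    using assms finite_edges_at by (simp add: sum.If_cases) (rule arg_cong[of _ _ card], auto)
  also have "\<dots> = card ((\<lambda>y. {x, y}) ` {y. {x, y} \<in> M})"
    by (rule card_image[symmetric]) (auto simp: inj_on_def doubleton_eq_iff)
  also have "(\<lambda>y. {x, y}) ` {y. {x, y} \<in> M} = {e \<in> M. x \<in> e}"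
  proof -
    have "e \<in> (\<lambda>y. {x, y}) ` {y. {x, y} \<in> M}" if "e \<in> M" "x \<in> e" for e
    proof -
      have "e \<in> E" using that assms by blast
      then obtain y where "e = {x, y}" using \<open>x \<in> e\<close> by (rule edgeE')
      then show ?thesis using that by blast
    qed
    then show ?thesis by auto
  qed
  finally show ?thesis .
qed

lemma occ_pm:
  assumes "M \<in> pm U"
  shows "occ V W (ind M) x = of_bool (x \<in> U)"
proof (cases "x \<in> U")
  case True
  then obtain e where e: "e \<in> M" "x \<in> e" using pmD(2)[OF assms] by blast
  then have "{f \<in> M. x \<in> f} = {e}" using pm_unique[OF assms] by blast
  then show ?thesis using True by (simp add: occ_ind[OF pmD(1)[OF assms]])
next
  case False
  then have "{f \<in> M. x \<in> f} = {}" using pmD(2)[OF assms] by blast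
  then have "card {f \<in> M. x \<in> f} = 0" by (metis card.empty)
  then show ?thesis using False by (simp add: occ_ind[OF pmD(1)[OF assms]])
qed

lemma pm_of_occ:
  assumes M: "M \<subseteq> E" and occ: "\<And>x. x \<in> V \<Longrightarrow> occ V W (ind M) x \<in> {0, 1}"
  shows "M \<in> pm {x \<in> V. occ V W (ind M) x = 1}"
proof (rule pmI[OF M])
  have fin: "finite {e \<in> M. x \<in> e}" for x using finite_subset[OF M finite_E] by simp
  show "\<Union>M = {x \<in> V. occ V W (ind M) x = 1}"
  proof
    show "\<Union>M \<subseteq> {x \<in> V. occ V W (ind M) x = 1}"
    proof
      fix x assume "x \<in> \<Union>M"
      then obtain e where e: "e \<in> M" "x \<in> e" by blast
      then have "x \<in> V" using edge_subset M by blast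
      moreover have "{e \<in> M. x \<in> e} \<noteq> {}" using e by blast
      ultimately show "x \<in> {x \<in> V. occ V W (ind M) x = 1}"
        using occ[of x] fin[of x] by (auto simp: occ_ind[OF M])
    qed
    show "{x \<in> V. occ V W (ind M) x = 1} \<subseteq> \<Union>M"
    proof
      fix x assume "x \<in> {x \<in> V. occ V W (ind M) x = 1}"
      then have "card {e \<in> M. x \<in> e} = 1" by (simp add: occ_ind[OF M])
      then have "{e \<in> M. x \<in> e} \<noteq> {}" by force
      then show "x \<in> \<Union>M" by blast
    qed
  qed
  show "e = f" if "e \<in> M" "f \<in> M" "x \<in> e" "x \<in> f" for e f x
  proof -
    have "x \<in> V" using that edge_subset M by blast
    then have "card {e \<in> M. x \<in> e} \<le> Suc 0" using occ[of x] by (auto simp: occ_ind[OF M])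
    then show ?thesis using card_le_Suc0_iff_eq[OF fin[of x]] that by blast
  qed
qed

text \<open>The covered set is the union of either matching, whence injectivity; conversely, equal
  occupation numbers mean that both matchings cover the same set.\<close>

lemma bij_mdd_configs:
  "bij_betw (\<lambda>(U, M1, M2). (ind M1, ind M2)) (SIGMA U:Pow V. pm U \<times> pm U) (mdd_configs V W)"
proof (rule bij_betw_imageI)
  show "inj_on (\<lambda>(U, M1, M2). (ind M1, ind M2)) (SIGMA U:Pow V. pm U \<times> pm U)"
    by (rule inj_onI) (auto dest!: ind_inj[rotated 2] dest: pmD)
  show "(\<lambda>(U, M1, M2). (ind M1, ind M2)) ` (SIGMA U:Pow V. pm U \<times> pm U) = mdd_configs V W"
  proof
    show "(\<lambda>(U, M1, M2). (ind M1, ind M2)) ` (SIGMA U:Pow V. pm U \<times> pm U) \<subseteq> mdd_configs V W"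
      by (auto simp: mdd_configs_def ind_dimers occ_pm)
    show "mdd_configs V W \<subseteq> (\<lambda>(U, M1, M2). (ind M1, ind M2)) ` (SIGMA U:Pow V. pm U \<times> pm U)"
    proof
      fix \<omega> assume \<omega>: "\<omega> \<in> mdd_configs V W"
      obtain m1 m2 where m: "\<omega> = (m1, m2)" by fastforce
      with \<omega> have d: "m1 \<in> dimers V W" "m2 \<in> dimers V W"
        and o: "\<And>x. x \<in> V \<Longrightarrow> occ V W m1 x = occ V W m2 x \<and> occ V W m1 x \<in> {0, 1}"
        by (auto simp: mdd_configs_def)
      obtain M1 M2 where M: "M1 \<subseteq> E" "m1 = ind M1" "M2 \<subseteq> E" "m2 = ind M2"
        using d by (meson dimers_ind)
      let ?U = "{x \<in> V. occ V W m1 x = 1}"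
      have "M1 \<in> pm ?U" unfolding M(2) by (rule pm_of_occ[OF M(1)]) (use o M(2) in force)
      moreover have "M2 \<in> pm {x \<in> V. occ V W m2 x = 1}"
        unfolding M(4) by (rule pm_of_occ[OF M(3)]) (use o M(4) in force)
      moreover have "{x \<in> V. occ V W m2 x = 1} = ?U" using o by auto
      ultimately have "(?U, M1, M2) \<in> (SIGMA U:Pow V. pm U \<times> pm U)" by auto
      then show "\<omega> \<in> (\<lambda>(U, M1, M2). (ind M1, ind M2)) ` (SIGMA U:Pow V. pm U \<times> pm U)"
        by (rule rev_image_eqI) (simp add: m M)
    qed
  qed
qed

lemma finite_mdd_configs: "finite (mdd_configs V W)"
  using bij_betw_finite[OF bij_mdd_configs] finite_V finite_pm by auto

lemma sum_mdd_configs: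
  "(\<Sum>\<omega>\<in>mdd_configs V W. F \<omega>) = (\<Sum>U\<in>Pow V. \<Sum>(M1, M2)\<in>pm U \<times> pm U. F (ind M1, ind M2))"
  for F :: "'a config \<Rightarrow> real"
proof -
  have "(\<Sum>\<omega>\<in>mdd_configs V W. F \<omega>)
    = (\<Sum>p\<in>(SIGMA U:Pow V. pm U \<times> pm U). F (case p of (U, M1, M2) \<Rightarrow> (ind M1, ind M2)))"
    by (rule sum.reindex_bij_betw[OF bij_mdd_configs, symmetric])
  also have "\<dots> = (\<Sum>U\<in>Pow V. \<Sum>n\<in>pm U \<times> pm U. F (case n of (M1, M2) \<Rightarrow> (ind M1, ind M2)))"
    using finite_V finite_pm by (subst sum.Sigma) (auto simp: case_prod_unfold)
  finally show ?thesis by (simp add: case_prod_unfold)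
qed

lemma prod_edges_ind:
  assumes "M \<subseteq> E" "N \<subseteq> E"
  shows "(\<Prod>e\<in>E. edge_weight W e ^ (ind M e + ind N e)) = ew M * ew N"
proof -
  have *: "(\<Prod>e\<in>E. edge_weight W e ^ ind M e) = ew M" if "M \<subseteq> E" for M
  proof -
    have "(\<Prod>e\<in>E. edge_weight W e ^ ind M e) = (\<Prod>e\<in>E. if e \<in> M then edge_weight W e else 1)"
      by (rule prod.cong) (auto simp: ind_def)
    also have "\<dots> = ew M" unfolding ew_def using finite_E that
      by (simp add: prod.If_cases Int_absorb1)
    finally show ?thesis .
  qed
  show ?thesis using assms by (simp add: power_add prod.distrib *)
qed

text \<open>Within \<open>V - S\<close> the vertices left free by the first matching are exactly
  those of \<open>V - U\<close>. With \<open>S = {}\<close> this serves the measure, with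
  \<open>S = {x, y}\<close> the two-point function.\<close>

lemma config_weight_pm:
  assumes "M1 \<in> pm (U - S)" "M2 \<in> pm U" "S \<subseteq> U"
  shows "config_weight V W (V - S) (ind M1, ind M2) = a ^ card (V - U) * (ew M1 * ew M2)"
proof -
  have "(\<Prod>z\<in>V - S. W z z ^ (1 - occ V W (ind M1) z)) = (\<Prod>z\<in>V - S. if z \<in> V - U then a else 1)"
    by (rule prod.cong) (auto simp: occ_pm[OF assms(1)] W_diag)
  also have "\<dots> = a ^ card ((V - S) \<inter> {z. z \<in> V - U})"
    using finite_V by (simp only: prod.If_cases finite_Diff) simp
  also have "(V - S) \<inter> {z. z \<in> V - U} = V - U" using assms(3) by auto
  finally show ?thesis
    using prod_edges_ind[OF pmD(1)[OF assms(1)] pmD(1)[OF assms(2)]] by (simp add: config_weight_def)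
qed

lemma config_weight_pm_V:
  assumes "M1 \<in> pm U" "M2 \<in> pm U"
  shows "config_weight V W V (ind M1, ind M2) = a ^ card (V - U) * (ew M1 * ew M2)"
  using config_weight_pm[of M1 U "{}" M2] assms by simp

lemma sum_config_weight:
  "(\<Sum>\<omega>\<in>mdd_configs V W. config_weight V W V \<omega> * F \<omega>)
    = (\<Sum>U\<in>Pow V. a ^ card (V - U) * (\<Sum>(M1, M2)\<in>pm U \<times> pm U. ew M1 * ew M2 * F (ind M1, ind M2)))"
  for F :: "'a config \<Rightarrow> real"
  unfolding sum_mdd_configs sum_distrib_left
  by (intro sum.cong refl) (auto simp: config_weight_pm_V)

lemma config_weight_nonneg: "\<omega> \<in> mdd_configs V W \<Longrightarrow> config_weight V W V \<omega> \<ge> 0"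
  using bij_betw_imp_surj_on[OF bij_mdd_configs, symmetric] a_pos
  by (auto simp: config_weight_pm_V ew_nonneg)

lemma sum_pm_pairs: "(\<Sum>(M1, M2)\<in>pm U \<times> pm U. ew M1 * ew M2) = (D U)\<^sup>2"
  unfolding D_def power2_eq_square sum_product by (rule sum.cartesian_product[symmetric])

lemma mdd_Z_eq: "mdd_Z V W = Z"
  using sum_config_weight[of "\<lambda>_. 1"] sum_pm_pairs by (simp add: mdd_Z_def Z_def nu_def)

lemma bij_mdd_configs2:
  assumes xy: "x \<in> V" "y \<in> V"
  shows "bij_betw (\<lambda>(U, M1, M2). (ind M1, ind M2))
    (SIGMA U:{U. U \<subseteq> V \<and> {x, y} \<subseteq> U}. pm (U - {x, y}) \<times> pm U) (mdd_configs2 V W x y)"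
    (is "bij_betw ?f ?S _")
proof (rule bij_betw_imageI)
  show "inj_on ?f ?S"
    by (rule inj_onI) (auto dest!: ind_inj[rotated 2] dest: pmD)
  show "?f ` ?S = mdd_configs2 V W x y"
  proof
    show "?f ` ?S \<subseteq> mdd_configs2 V W x y"
      by (auto simp: mdd_configs2_def ind_dimers occ_pm)
    show "mdd_configs2 V W x y \<subseteq> ?f ` ?S"
    proof
      fix \<omega> assume \<omega>: "\<omega> \<in> mdd_configs2 V W x y"
      obtain m1 m2 where m: "\<omega> = (m1, m2)" by fastforce
      have "(m1, m2) \<in> mdd_configs2 V W x y" using \<omega> m by simp
      then have d: "m1 \<in> dimers V W" "m2 \<in> dimers V W"
        and o: "\<And>z. z \<in> V - {x, y} \<Longrightarrow> occ V W m1 z = occ V W m2 z \<and> occ V W m1 z \<in> {0, 1}"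
        and oxy: "occ V W m1 x = 0" "occ V W m1 y = 0" "occ V W m2 x = 1" "occ V W m2 y = 1"
        unfolding mdd_configs2_def by blast+
      obtain M1 M2 where M: "M1 \<subseteq> E" "m1 = ind M1" "M2 \<subseteq> E" "m2 = ind M2"
        using d by (meson dimers_ind)
      have o1: "occ V W m1 z \<in> {0, 1}" if "z \<in> V" for z
        using o[of z] oxy that by (cases "z = x \<or> z = y") auto
      have o2: "occ V W m2 z \<in> {0, 1}" if "z \<in> V" for z
        using o[of z] oxy that by (cases "z = x \<or> z = y") auto
      let ?U = "{x \<in> V. occ V W m2 x = 1}"
      have "M2 \<in> pm ?U" unfolding M(4) by (rule pm_of_occ[OF M(3)]) (use o2 M(4) in auto)
      moreover have "M1 \<in> pm {x \<in> V. occ V W m1 x = 1}"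
        unfolding M(2) by (rule pm_of_occ[OF M(1)]) (use o1 M(2) in auto)
      moreover have "{x \<in> V. occ V W m1 x = 1} = ?U - {x, y}"
      proof -
        have "occ V W m1 z = 1 \<longleftrightarrow> occ V W m2 z = 1 \<and> z \<noteq> x \<and> z \<noteq> y" if "z \<in> V" for z
          using o[of z] oxy that by (cases "z = x \<or> z = y") auto
        then show ?thesis by auto
      qed
      ultimately have "(?U, M1, M2) \<in> ?S" using xy oxy by auto
      then show "\<omega> \<in> ?f ` ?S"
        by (rule rev_image_eqI) (simp add: m M)
    qed
  qed
qed

lemma mdd_G_eq:
  assumes xy: "x \<in> V" "y \<in> V" "x \<noteq> y"
  shows "mdd_G V W x y = overlap {x, y} {} / Z"
proof -
  let ?A = "{U. U \<subseteq> V \<and> {x, y} \<subseteq> U}"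
  let ?c = "config_weight V W (V - {x, y})"
  have finA: "finite ?A" by (rule finite_subset[of _ "Pow V"]) (auto simp: finite_V)
  have "(\<Sum>\<omega>\<in>mdd_configs2 V W x y. ?c \<omega>)
    = (\<Sum>p\<in>(SIGMA U:?A. pm (U - {x, y}) \<times> pm U). ?c (case p of (U, M1, M2) \<Rightarrow> (ind M1, ind M2)))"
    by (rule sum.reindex_bij_betw[OF bij_mdd_configs2[OF xy(1,2)], symmetric])
  also have "\<dots> = (\<Sum>U\<in>?A. \<Sum>n\<in>pm (U - {x, y}) \<times> pm U. ?c (case n of (M1, M2) \<Rightarrow> (ind M1, ind M2)))"
    using finA finite_pm by (subst sum.Sigma) (auto simp: case_prod_unfold)
  also have "\<dots> = (\<Sum>U\<in>?A. \<Sum>(M1, M2)\<in>pm (U - {x, y}) \<times> pm U. a ^ card (V - U) * (ew M1 * ew M2))"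
    by (intro sum.cong refl) (auto simp: config_weight_pm)
  also have "\<dots> = (\<Sum>U\<in>?A. a ^ card (V - U) * D (U - {x, y}) * D U)"
  proof (rule sum.cong[OF refl])
    fix U
    have "D (U - {x, y}) * D U = (\<Sum>(M1, M2)\<in>pm (U - {x, y}) \<times> pm U. ew M1 * ew M2)"
      unfolding D_def sum_product by (rule sum.cartesian_product)
    then show "(\<Sum>(M1, M2)\<in>pm (U - {x, y}) \<times> pm U. a ^ card (V - U) * (ew M1 * ew M2))
      = a ^ card (V - U) * D (U - {x, y}) * D U"
      by (simp only: mult.assoc sum_distrib_left case_prod_unfold)
  qed
  also have "\<dots> = overlap {x, y} {}" by (simp add: overlap_def)
  finally show ?thesis using xy(3) by (simp add: mdd_G_def mdd_Z_eq)
qed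

section \<open>Loop lengths and pairs of opposite colour\<close>

lemma loop_vertices_ind:
  assumes "M1 \<subseteq> E" "M2 \<subseteq> E"
  shows "loop_vertices V W x (ind M1, ind M2) = comp (M1 \<union> M2) x"
proof -
  have "{(u, v). {u, v} \<in> E \<and> ind M1 {u, v} + ind M2 {u, v} > 0} = {(u, v). {u, v} \<in> M1 \<union> M2}"
    using assms by (auto simp: ind_def)
  then show ?thesis by (simp add: loop_vertices_def comp_def)
qed

text \<open>Every dimer has an endpoint of colour \<open>c\<close>, so the vertices of that colour
  map onto the dimers. The colour stays free because \<open>max_loop_length_sq_le\<close> uses both
  values.\<close>

lemma card_pm_inside_le:
  assumes M: "M \<in> pm U"
  shows "card {e \<in> M. e \<subseteq> C} \<le> card {z \<in> C \<inter> V. s z = c}"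
proof (rule surj_card_le[where f = "\<lambda>z. SOME e. e \<in> M \<and> z \<in> e"])
  show "finite {z \<in> C \<inter> V. s z = c}" using finite_V by simp
  show "{e \<in> M. e \<subseteq> C} \<subseteq> (\<lambda>z. SOME e. e \<in> M \<and> z \<in> e) ` {z \<in> C \<inter> V. s z = c}"
  proof
    fix e assume e: "e \<in> {e \<in> M. e \<subseteq> C}"
    then have "e \<in> E" using pmD(1)[OF M] by blast
    then have "\<exists>z\<in>e. z \<in> V \<and> s z = c" by (rule edgeE) (cases c, auto)
    then obtain z where z: "z \<in> e" "z \<in> V" "s z = c" by blast
    have "(SOME f. f \<in> M \<and> z \<in> f) = e"
      by (rule some_equality) (use e z pm_unique[OF M] in auto)
    then show "e \<in> (\<lambda>z. SOME e. e \<in> M \<and> z \<in> e) ` {z \<in> C \<inter> V. s z = c}"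
      using e z by (intro image_eqI[of _ _ z]) auto
  qed
qed

lemma card_pm_le: "M \<in> pm U \<Longrightarrow> card M \<le> card V"
proof -
  assume M: "M \<in> pm U"
  have "{e \<in> M. e \<subseteq> UNIV} = M" by auto
  then have "card M \<le> card {z \<in> UNIV \<inter> V. s z = True}" using card_pm_inside_le[OF M, of UNIV True] by simp
  also have "\<dots> \<le> card V" by (rule card_mono) (auto simp: finite_V)
  finally show ?thesis .
qed

lemma loop_length_le:
  assumes M1: "M1 \<in> pm U" and M2: "M2 \<in> pm U"
  shows "loop_length V W x (ind M1, ind M2) \<le> 2 * card {z \<in> comp (M1 \<union> M2) x \<inter> V. s z = c}"
proof -
  let ?C = "comp (M1 \<union> M2) x"
  have *: "(\<Sum>e\<in>{e \<in> E. e \<subseteq> ?C}. ind M e) = card {e \<in> M. e \<subseteq> ?C}" if "M \<subseteq> E" for M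
  proof -
    have "(\<Sum>e\<in>{e \<in> E. e \<subseteq> ?C}. ind M e) = (\<Sum>e\<in>{e \<in> E. e \<subseteq> ?C}. if e \<in> M then 1 else 0)"
      by (rule sum.cong) (auto simp: ind_def)
    also have "\<dots> = card ({e \<in> E. e \<subseteq> ?C} \<inter> {e. e \<in> M})" using finite_E by (simp add: sum.If_cases)
    also have "{e \<in> E. e \<subseteq> ?C} \<inter> {e. e \<in> M} = {e \<in> M. e \<subseteq> ?C}" using that by auto
    finally show ?thesis .
  qed
  have "loop_length V W x (ind M1, ind M2) = card {e \<in> M1. e \<subseteq> ?C} + card {e \<in> M2. e \<subseteq> ?C}"
    using loop_vertices_ind[OF pmD(1)[OF M1] pmD(1)[OF M2]]
    by (simp add: loop_length_def sum.distrib *[OF pmD(1)[OF M1]] *[OF pmD(1)[OF M2]])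
  also have "\<dots> \<le> 2 * card {z \<in> ?C \<inter> V. s z = c}"
    using card_pm_inside_le[OF M1, of ?C c] card_pm_inside_le[OF M2, of ?C c] by simp
  finally show ?thesis .
qed

definition bichrom :: "('a \<times> 'a) set" where
  "bichrom = {(p, q) \<in> V \<times> V. s p \<and> \<not> s q}"

lemma finite_bichrom: "finite bichrom"
  by (rule finite_subset[of _ "V \<times> V"]) (auto simp: bichrom_def finite_V)

text \<open>One factor of the square is bounded by the vertices of colour \<open>True\<close>, the
  other by those of colour \<open>False\<close>. The product counts pairs of opposite colour on one
  loop, which is the situation that the surgery can treat.\<close>

lemma max_loop_length_sq_le:
  assumes M1: "M1 \<in> pm U" and M2: "M2 \<in> pm U" and V: "V \<noteq> {}"
  shows "(max_loop_length V W (ind M1, ind M2))\<^sup>2 \<le> 4 * card {(p, q) \<in> bichrom. q \<in> comp (M1 \<union> M2) p}"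
proof -
  let ?l = "\<lambda>x. loop_length V W x (ind M1, ind M2)"
  have "max_loop_length V W (ind M1, ind M2) \<in> ?l ` V"
    unfolding max_loop_length_def using finite_V V by (intro Max_in) auto
  then obtain x where x: "max_loop_length V W (ind M1, ind M2) = ?l x" by blast
  let ?C = "\<lambda>c. {z \<in> comp (M1 \<union> M2) x \<inter> V. s z = c}"
  have "?l x * ?l x \<le> (2 * card (?C True)) * (2 * card (?C False))"
    by (intro mult_mono loop_length_le[OF M1 M2]) auto
  also have "\<dots> = 4 * card (?C True \<times> ?C False)" by (simp add: card_cartesian_product)
  also have "card (?C True \<times> ?C False) \<le> card {(p, q) \<in> bichrom. q \<in> comp (M1 \<union> M2) p}"
  proof (rule card_mono)
    show "finite {(p, q) \<in> bichrom. q \<in> comp (M1 \<union> M2) p}"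
      by (rule finite_subset[OF _ finite_bichrom]) auto
    show "?C True \<times> ?C False \<subseteq> {(p, q) \<in> bichrom. q \<in> comp (M1 \<union> M2) p}"
      by (auto simp: bichrom_def intro: comp_trans[OF comp_sym])
  qed
  finally show ?thesis by (simp add: x power2_eq_square)
qed

text \<open>The colours order the two endpoints of a dimer, so each dimer gives at most one
  pair.\<close>

lemma card_bichrom_edges_le:
  assumes M: "M \<in> pm U"
  shows "card {(p, q) \<in> bichrom. {p, q} \<in> M} \<le> card V"
proof -
  have "card {(p, q) \<in> bichrom. {p, q} \<in> M} = card ((\<lambda>(p, q). {p, q}) ` {(p, q) \<in> bichrom. {p, q} \<in> M})"
    by (rule card_image[symmetric]) (auto simp: inj_on_def bichrom_def doubleton_eq_iff)
  also have "\<dots> \<le> card M" by (rule card_mono) (use pmD(3)[OF M] in auto)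
  also have "\<dots> \<le> card V" by (rule card_pm_le[OF M])
  finally show ?thesis .
qed

text \<open>Pairs joined by a dimer of \<open>M2\<close> produce the first term, which is only
  linear in the volume and so negligible against its square; all other pairs on a common loop belong
  to \<open>loop_pairs\<close>.\<close>

lemma sum_max_loop_length_sq_le:
  assumes V: "V \<noteq> {}"
  shows "(\<Sum>\<omega>\<in>mdd_configs V W. config_weight V W V \<omega> * (real (max_loop_length V W \<omega>))\<^sup>2)
    \<le> 4 * (real (card V) * Z +
        (\<Sum>(p, q)\<in>bichrom. \<Sum>(u, v)\<in>cuts p q. W p u * W q v * overlap {p, q} {u, v}))"
proof -
  let ?P = "\<lambda>U. pm U \<times> pm U"
  have ptw: "(real (max_loop_length V W (ind M1, ind M2)))\<^sup>2
      \<le> 4 * (real (card V) + (\<Sum>(p, q)\<in>bichrom. of_bool ((M1, M2) \<in> loop_pairs U p q)))"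
    if "M1 \<in> pm U" "M2 \<in> pm U" for U M1 M2
  proof -
    let ?B = "{(p, q) \<in> bichrom. q \<in> comp (M1 \<union> M2) p}"
    let ?B1 = "{(p, q) \<in> bichrom. {p, q} \<in> M2}" and ?B2 = "{(p, q) \<in> bichrom. (M1, M2) \<in> loop_pairs U p q}"
    have fin: "finite ?B1" "finite ?B2"
      by (rule finite_subset[OF _ finite_bichrom], auto)+
    have "card ?B \<le> card (?B1 \<union> ?B2)"
      using fin that by (intro card_mono) (auto simp: loop_pairs_def)
    also have "\<dots> \<le> card ?B1 + card ?B2" by (rule card_Un_le)
    also have "\<dots> \<le> card V + card ?B2" using card_bichrom_edges_le[OF that(2)] by simp
    finally have "card ?B \<le> card V + card ?B2" .
    then have "(max_loop_length V W (ind M1, ind M2))\<^sup>2 \<le> 4 * (card V + card ?B2)"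
      using max_loop_length_sq_le[OF that V] by (meson le_trans mult_le_mono2)
    then have "real ((max_loop_length V W (ind M1, ind M2))\<^sup>2) \<le> real (4 * (card V + card ?B2))"
      by (rule of_nat_mono)
    moreover have "(\<Sum>(p, q)\<in>bichrom. of_bool ((M1, M2) \<in> loop_pairs U p q)) = real (card ?B2)"
    proof -
      have "real (card ?B2) = (\<Sum>x\<in>{x \<in> bichrom. case x of (p, q) \<Rightarrow> (M1, M2) \<in> loop_pairs U p q}. 1)"
        by (simp add: case_prod_unfold)
      also have "\<dots> = (\<Sum>(p, q)\<in>bichrom. of_bool ((M1, M2) \<in> loop_pairs U p q))"
        by (subst sum_indicator_mult[OF finite_bichrom]) (simp add: case_prod_unfold)
      finally show ?thesis by simp
    qed
    ultimately show ?thesis by simp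
  qed
  have "(\<Sum>\<omega>\<in>mdd_configs V W. config_weight V W V \<omega> * (real (max_loop_length V W \<omega>))\<^sup>2)
    = (\<Sum>U\<in>Pow V. a ^ card (V - U) * (\<Sum>(M1, M2)\<in>?P U. ew M1 * ew M2 * (real (max_loop_length V W (ind M1, ind M2)))\<^sup>2))"
    by (rule sum_config_weight)
  also have "\<dots> \<le> (\<Sum>U\<in>Pow V. a ^ card (V - U) * (\<Sum>(M1, M2)\<in>?P U. ew M1 * ew M2 *
      (4 * (real (card V) + (\<Sum>(p, q)\<in>bichrom. of_bool ((M1, M2) \<in> loop_pairs U p q))))))"
    using a_pos ptw by (intro sum_mono mult_left_mono) (auto intro!: mult_nonneg_nonneg ew_nonneg mult_left_mono)
  also have "\<dots> = (\<Sum>U\<in>Pow V. a ^ card (V - U) * (4 * (real (card V) * (D U)\<^sup>2 +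
      (\<Sum>(p, q)\<in>bichrom. \<Sum>(M1, M2)\<in>loop_pairs U p q. ew M1 * ew M2))))"
  proof (rule sum.cong[OF refl])
    fix U
    have "(\<Sum>(p, q)\<in>bichrom. \<Sum>(M1, M2)\<in>loop_pairs U p q. ew M1 * ew M2)
      = (\<Sum>x\<in>bichrom. \<Sum>m\<in>?P U. of_bool (m \<in> loop_pairs U (fst x) (snd x)) * (ew (fst m) * ew (snd m)))"
    proof (rule sum.cong[OF refl])
      fix x :: "'a \<times> 'a"
      have "loop_pairs U (fst x) (snd x) = {m \<in> ?P U. m \<in> loop_pairs U (fst x) (snd x)}"
        by (auto simp: loop_pairs_def)
      then have "(\<Sum>m\<in>loop_pairs U (fst x) (snd x). ew (fst m) * ew (snd m))
        = (\<Sum>m\<in>{m \<in> ?P U. m \<in> loop_pairs U (fst x) (snd x)}. ew (fst m) * ew (snd m))" by simp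
      also have "\<dots> = (\<Sum>m\<in>?P U. of_bool (m \<in> loop_pairs U (fst x) (snd x)) * (ew (fst m) * ew (snd m)))"
        by (rule sum_indicator_mult) (simp add: finite_pm)
      finally show "(case x of (p, q) \<Rightarrow> \<Sum>(M1, M2)\<in>loop_pairs U p q. ew M1 * ew M2) =
        (\<Sum>m\<in>?P U. of_bool (m \<in> loop_pairs U (fst x) (snd x)) * (ew (fst m) * ew (snd m)))"
        by (simp add: case_prod_unfold)
    qed
    also have "\<dots> = (\<Sum>m\<in>?P U. \<Sum>x\<in>bichrom. of_bool (m \<in> loop_pairs U (fst x) (snd x)) * (ew (fst m) * ew (snd m)))"
      by (rule sum.swap)
    finally have eq: "(\<Sum>(p, q)\<in>bichrom. \<Sum>(M1, M2)\<in>loop_pairs U p q. ew M1 * ew M2) = \<dots>" .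
    have "(\<Sum>(M1, M2)\<in>?P U. ew M1 * ew M2 *
        (4 * (real (card V) + (\<Sum>(p, q)\<in>bichrom. of_bool ((M1, M2) \<in> loop_pairs U p q)))))
      = 4 * (real (card V) * (\<Sum>(M1, M2)\<in>?P U. ew M1 * ew M2) +
         (\<Sum>m\<in>?P U. \<Sum>x\<in>bichrom. of_bool (m \<in> loop_pairs U (fst x) (snd x)) * (ew (fst m) * ew (snd m))))"
      by (simp add: case_prod_unfold sum_distrib_left sum.distrib[symmetric] algebra_simps)
    then show "a ^ card (V - U) * (\<Sum>(M1, M2)\<in>?P U. ew M1 * ew M2 *
        (4 * (real (card V) + (\<Sum>(p, q)\<in>bichrom. of_bool ((M1, M2) \<in> loop_pairs U p q)))))
      = a ^ card (V - U) * (4 * (real (card V) * (D U)\<^sup>2 +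
        (\<Sum>(p, q)\<in>bichrom. \<Sum>(M1, M2)\<in>loop_pairs U p q. ew M1 * ew M2)))"
      unfolding eq sum_pm_pairs by simp
  qed
  also have "\<dots> = 4 * (real (card V) * Z + (\<Sum>x\<in>bichrom. \<Sum>U\<in>Pow V. a ^ card (V - U) *
      (\<Sum>(M1, M2)\<in>loop_pairs U (fst x) (snd x). ew M1 * ew M2)))"
  proof -
    have "(\<Sum>x\<in>bichrom. \<Sum>U\<in>Pow V. a ^ card (V - U) * (\<Sum>(M1, M2)\<in>loop_pairs U (fst x) (snd x). ew M1 * ew M2))
      = (\<Sum>U\<in>Pow V. a ^ card (V - U) * (\<Sum>x\<in>bichrom. (\<Sum>(M1, M2)\<in>loop_pairs U (fst x) (snd x). ew M1 * ew M2)))"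
      unfolding sum_distrib_left by (rule sum.swap)
    then show ?thesis
      by (simp add: Z_def nu_def case_prod_unfold sum.distrib[symmetric] sum_distrib_left algebra_simps)
  qed
  also have "\<dots> \<le> 4 * (real (card V) * Z + (\<Sum>x\<in>bichrom.
        \<Sum>(u, v)\<in>cuts (fst x) (snd x). W (fst x) u * W (snd x) v * overlap {fst x, snd x} {u, v}))"
    by (intro mult_left_mono add_left_mono sum_mono loop_pairs_total_le) (auto simp: bichrom_def)
  finally show ?thesis by (simp add: case_prod_unfold)
qed

section \<open>Symmetries of the weights\<close>

definition automorphism :: "('a \<Rightarrow> 'a) \<Rightarrow> bool" where
  "automorphism \<tau> \<longleftrightarrow> bij_betw \<tau> V V \<and> (\<forall>x\<in>V. \<forall>y\<in>V. W (\<tau> x) (\<tau> y) = W x y)"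

lemma automorphism_inv:
  assumes "automorphism \<tau>"
  shows "automorphism (inv_into V \<tau>)"
proof -
  have bij: "bij_betw \<tau> V V" and inv: "\<And>x y. x \<in> V \<Longrightarrow> y \<in> V \<Longrightarrow> W (\<tau> x) (\<tau> y) = W x y"
    using assms by (auto simp: automorphism_def)
  have bij': "bij_betw (inv_into V \<tau>) V V" by (rule bij_betw_inv_into[OF bij])
  have "W (inv_into V \<tau> x) (inv_into V \<tau> y) = W x y" if "x \<in> V" "y \<in> V" for x y
    using inv[of "inv_into V \<tau> x" "inv_into V \<tau> y"] that bij bij_betw_apply[OF bij']
    by (simp add: bij_betw_inv_into_right)
  with bij' show ?thesis by (simp add: automorphism_def)
qed

text \<open>Transporting matchings along \<tau> is injective and preserves weights. The reverse
  inequality comes from the inverse of \<tau>.\<close>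

lemma D_le_automorphism:
  assumes \<tau>: "automorphism \<tau>"
  shows "D U \<le> D (\<tau> ` U)"
proof -
  let ?h = "(`) ((`) \<tau>)"
  have inj: "inj_on \<tau> V" and inv: "\<And>x y. x \<in> V \<Longrightarrow> y \<in> V \<Longrightarrow> W (\<tau> x) (\<tau> y) = W x y"
    and V: "\<And>x. x \<in> V \<Longrightarrow> \<tau> x \<in> V"
    using \<tau> by (auto simp: automorphism_def bij_betw_def)
  have injE: "inj_on ((`) \<tau>) (Pow V)" by (rule inj_on_image_Pow[OF inj])
  have edge: "\<tau> ` e \<in> E \<and> edge_weight W (\<tau> ` e) = edge_weight W e" if "e \<in> E" for e
  proof -
    obtain x y where e: "e = {x, y}" "x \<in> V" "y \<in> V" "x \<noteq> y" "W x y > 0"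
      using \<open>e \<in> E\<close> by (rule edgeE)
    then have "\<tau> x \<noteq> \<tau> y" using inj by (auto dest: inj_onD)
    then have "{\<tau> x, \<tau> y} \<in> E"
      unfolding edges_def
      by (intro CollectI exI[of _ "\<tau> x"] exI[of _ "\<tau> y"]) (use e V inv in auto)
    then show ?thesis using e inv by (simp add: edge_weight_W)
  qed
  have pm: "?h M \<in> pm (\<tau> ` U) \<and> ew (?h M) = ew M" if M: "M \<in> pm U" for M
  proof
    have sub: "M \<subseteq> Pow V" using pmD(1)[OF M] edge_subset by blast
    show "?h M \<in> pm (\<tau> ` U)"
    proof (rule pmI)
      show "?h M \<subseteq> E" using edge pmD(1)[OF M] by blast
      show "\<Union> (?h M) = \<tau> ` U" using pmD(2)[OF M] by blast
      fix e f x assume "e \<in> ?h M" "f \<in> ?h M" "x \<in> e" "x \<in> f"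
      then obtain e' f' p q where *: "e' \<in> M" "f' \<in> M" "e = \<tau> ` e'" "f = \<tau> ` f'"
        "p \<in> e'" "q \<in> f'" "\<tau> p = \<tau> q" by auto
      then have "p = q" using inj sub by (auto dest!: inj_onD)
      with * show "e = f" using pm_unique[OF M] by blast
    qed
    have "ew (?h M) = (\<Prod>e\<in>M. edge_weight W (\<tau> ` e))"
      unfolding ew_def by (rule prod.reindex_cong[OF inj_on_subset[OF injE sub]]) auto
    also have "\<dots> = ew M" unfolding ew_def by (rule prod.cong) (use edge pmD(1)[OF M] in auto)
    finally show "ew (?h M) = ew M" .
  qed
  have injM: "inj_on ?h (pm U)"
  proof (rule inj_on_subset)
    show "inj_on ?h (Pow (Pow V))" by (rule inj_on_image_Pow[OF injE])
    show "pm U \<subseteq> Pow (Pow V)" using pmD(1) edge_subset by blast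
  qed
  have "D U = (\<Sum>M\<in>?h ` pm U. ew M)"
    unfolding D_def by (subst sum.reindex[OF injM]) (use pm in \<open>auto intro!: sum.cong\<close>)
  also have "\<dots> \<le> D (\<tau> ` U)"
    unfolding D_def by (rule sum_mono2) (use pm in \<open>auto simp: finite_pm intro: ew_nonneg\<close>)
  finally show ?thesis .
qed

lemma D_automorphism:
  assumes \<tau>: "automorphism \<tau>" and U: "U \<subseteq> V"
  shows "D (\<tau> ` U) = D U"
proof (rule antisym)
  have "inv_into V \<tau> ` \<tau> ` U = U"
    using \<tau> U by (auto simp: automorphism_def bij_betw_def inv_into_image_cancel)
  then show "D (\<tau> ` U) \<le> D U"
    using D_le_automorphism[OF automorphism_inv[OF \<tau>], of "\<tau> ` U"] by simp
qed (rule D_le_automorphism[OF \<tau>])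

lemma EE_automorphism:
  assumes \<tau>: "automorphism \<tau>"
  shows "EE (\<lambda>U. g (\<tau> ` U)) = EE g"
proof -
  have bij: "bij_betw \<tau> V V" using \<tau> by (simp add: automorphism_def)
  have bijP: "bij_betw ((`) \<tau>) (Pow V) (Pow V)" by (rule bij_betw_Pow[OF bij])
  have "nu (\<tau> ` U) = nu U" if "U \<subseteq> V" for U
  proof -
    have inj: "inj_on \<tau> V" using bij by (simp add: bij_betw_def)
    have "V - \<tau> ` U = \<tau> ` V - \<tau> ` U" using bij by (simp add: bij_betw_def)
    also have "\<dots> = \<tau> ` (V - U)" by (rule inj_on_image_set_diff[OF inj, symmetric]) (use that in auto)
    finally have "card (V - \<tau> ` U) = card (V - U)"
      using card_image[OF inj_on_subset[OF inj]] by simp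
    then show ?thesis by (simp add: nu_def D_automorphism[OF \<tau> that])
  qed
  then have "EE (\<lambda>U. g (\<tau> ` U)) = (\<Sum>U\<in>Pow V. nu (\<tau> ` U) * g (\<tau> ` U))"
    unfolding EE_def by (intro sum.cong) auto
  also have "\<dots> = EE g" unfolding EE_def by (rule sum.reindex_bij_betw[OF bijP])
  finally show ?thesis .
qed

lemma charge_sum: "charge (\<lambda>z. \<Sum>i\<in>I. b i z) U = (\<Sum>i\<in>I. charge (b i) U)"
  unfolding charge_def sum_distrib_left by (rule sum.swap)

lemma charge_cmult: "charge (\<lambda>z. c * b z) U = c * charge b U"
  unfolding charge_def by (simp add: sum_distrib_left mult_ac)

lemma EE_square_sum:
  "EE (\<lambda>U. (\<Sum>i\<in>I. f i U)\<^sup>2) = (\<Sum>i\<in>I. \<Sum>j\<in>I. EE (\<lambda>U. f i U * f j U))"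
  unfolding power2_eq_square sum_product by (simp add: EE_sum)

section \<open>Expectations and probabilities under the model measure\<close>

definition prw :: "'a config \<Rightarrow> real" where
  "prw \<omega> = config_weight V W V \<omega> / Z"

lemma prw_nonneg: "\<omega> \<in> mdd_configs V W \<Longrightarrow> prw \<omega> \<ge> 0"
  unfolding prw_def using config_weight_nonneg Z_pos by simp

lemma sum_prw: "(\<Sum>\<omega>\<in>mdd_configs V W. prw \<omega>) = 1"
  unfolding prw_def sum_divide_distrib[symmetric] mdd_Z_def[symmetric] mdd_Z_eq
  using Z_pos by simp

lemma mdd_measure_prw: "mdd_measure V W = point_measure (mdd_configs V W) (\<lambda>\<omega>. ennreal (prw \<omega>))"
  by (simp add: mdd_measure_def prw_def mdd_Z_eq)

lemma integral_mdd:
  "(\<integral>\<omega>. f \<omega> \<partial>mdd_measure V W) = (\<Sum>\<omega>\<in>mdd_configs V W. prw \<omega> * f \<omega>)" for f :: "'a config \<Rightarrow> real"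
  unfolding mdd_measure_prw
  by (subst lebesgue_integral_point_measure_finite) (simp_all add: finite_mdd_configs prw_nonneg)

lemma integral_mdd_mono:
  fixes f g :: "'a config \<Rightarrow> real"
  assumes "\<And>\<omega>. \<omega> \<in> mdd_configs V W \<Longrightarrow> f \<omega> \<le> g \<omega>"
  shows "(\<integral>\<omega>. f \<omega> \<partial>mdd_measure V W) \<le> (\<integral>\<omega>. g \<omega> \<partial>mdd_measure V W)"
  unfolding integral_mdd by (intro sum_mono mult_left_mono prw_nonneg assms)

text \<open>Nonnegativity of the variance.\<close>

lemma integral_mdd_square:
  fixes f :: "'a config \<Rightarrow> real"
  shows "(\<integral>\<omega>. f \<omega> \<partial>mdd_measure V W)\<^sup>2 \<le> (\<integral>\<omega>. (f \<omega>)\<^sup>2 \<partial>mdd_measure V W)"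
proof -
  let ?A = "mdd_configs V W"
  define m where "m = (\<Sum>\<omega>\<in>?A. prw \<omega> * f \<omega>)"
  have "0 \<le> (\<Sum>\<omega>\<in>?A. prw \<omega> * (f \<omega> - m)\<^sup>2)"
    by (intro sum_nonneg mult_nonneg_nonneg prw_nonneg) auto
  also have "\<dots> = (\<Sum>\<omega>\<in>?A. prw \<omega> * (f \<omega>)\<^sup>2 - 2 * m * (prw \<omega> * f \<omega>) + m\<^sup>2 * prw \<omega>)"
    by (rule sum.cong) (auto simp: power2_eq_square algebra_simps)
  also have "\<dots> = (\<Sum>\<omega>\<in>?A. prw \<omega> * (f \<omega>)\<^sup>2) - 2 * m * m + m\<^sup>2"
    unfolding sum.distrib sum_subtractf sum_distrib_left[symmetric] sum_prw by (simp add: m_def)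
  finally show ?thesis unfolding integral_mdd m_def[symmetric] by (simp add: power2_eq_square)
qed

lemma markov_mdd:
  fixes f :: "'a config \<Rightarrow> real"
  assumes "c > 0" "\<And>\<omega>. f \<omega> \<ge> 0"
  shows "measure (mdd_measure V W) {\<omega> \<in> space (mdd_measure V W). f \<omega> \<ge> c}
    \<le> (\<integral>\<omega>. f \<omega> \<partial>mdd_measure V W) / c"
proof -
  let ?A = "mdd_configs V W"
  have sp: "space (mdd_measure V W) = ?A" by (simp add: mdd_measure_def space_point_measure)
  have "measure (mdd_measure V W) {\<omega> \<in> ?A. f \<omega> \<ge> c} = (\<Sum>\<omega>\<in>{\<omega> \<in> ?A. f \<omega> \<ge> c}. prw \<omega>)"
    unfolding mdd_measure_prw
    by (subst measure_point_measure_finite_if) (auto simp: finite_mdd_configs prw_nonneg)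
  also have "\<dots> \<le> (\<Sum>\<omega>\<in>{\<omega> \<in> ?A. f \<omega> \<ge> c}. prw \<omega> * (f \<omega> / c))"
  proof (rule sum_mono)
    fix \<omega> assume \<omega>: "\<omega> \<in> {\<omega> \<in> ?A. f \<omega> \<ge> c}"
    then have "prw \<omega> * 1 \<le> prw \<omega> * (f \<omega> / c)"
      using assms(1) by (intro mult_left_mono prw_nonneg) auto
    then show "prw \<omega> \<le> prw \<omega> * (f \<omega> / c)" by simp
  qed
  also have "\<dots> \<le> (\<Sum>\<omega>\<in>?A. prw \<omega> * (f \<omega> / c))"
    by (rule sum_mono2) (use finite_mdd_configs prw_nonneg assms in auto)
  also have "\<dots> = (\<integral>\<omega>. f \<omega> \<partial>mdd_measure V W) / c"
    unfolding integral_mdd by (simp add: sum_divide_distrib)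
  finally show ?thesis by (simp add: sp)
qed

end

section \<open>Two elementary sums\<close>

lemma sum_telescope_le:
  fixes v :: "nat \<Rightarrow> real"
  assumes v: "\<And>k. v k \<ge> 0" and C: "\<And>k. k \<le> n + M \<Longrightarrow> v k \<le> C" and "n \<le> M"
  shows "(\<Sum>N=1..M. v (N + n) - v (if n \<le> N then N - n else n - N)) \<le> 2 * real n * C"
proof -
  \<comment> \<open>Telescoping with gap \<open>2 * n\<close>: passing from \<open>M\<close> to
    \<open>M + 1\<close> adds \<open>v (M + 1 + n)\<close> and subtracts
    \<open>v (M + 1 - n)\<close>, which moves a window of \<open>2 * n\<close> consecutive indices
    by one. For \<open>M = n\<close> the subtracted terms are dropped and the window is filled up by
    nonnegative terms.\<close>
  have "(\<Sum>N=1..M. v (N + n) - v (if n \<le> N then N - n else n - N)) \<le> (\<Sum>k=M-n+1..M+n. v k)"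
    using \<open>n \<le> M\<close>
  proof (induction M rule: dec_induct)
    case base
    have "(\<Sum>N=1..n. v (N + n) - v (if n \<le> N then N - n else n - N)) \<le> (\<Sum>N=1..n. v (N + n))"
      by (rule sum_mono) (use v in simp)
    also have "\<dots> = sum v {1+n..n+n}" by (rule sum.shift_bounds_cl_nat_ivl[symmetric])
    also have "\<dots> \<le> (\<Sum>k=n-n+1..n+n. v k)" by (rule sum_mono2) (use v in auto)
    finally show ?case .
  next
    case (step M)
    have "(\<Sum>k=M-n+1..Suc M+n. v k) = (\<Sum>k=M-n+1..M+n. v k) + v (Suc M + n)" by simp
    moreover have "(\<Sum>k=M-n+1..Suc M+n. v k) = v (M - n + 1) + (\<Sum>k=Suc M-n+1..Suc M+n. v k)"
      using \<open>n \<le> M\<close> by (subst sum.atLeast_Suc_atMost) (auto simp: Suc_diff_le)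
    moreover have "Suc M - n = M - n + 1" using \<open>n \<le> M\<close> by simp
    ultimately show ?case using step by (simp add: Suc_diff_le)
  qed
  also have "\<dots> \<le> real (card {M-n+1..M+n}) * C" by (rule sum_bounded_above) (use C in auto)
  also have "real (card {M-n+1..M+n}) = 2 * real n" using \<open>n \<le> M\<close> by simp
  finally show ?thesis .
qed

text \<open>Two geometric series, one on each side of \<open>i\<close>, each at most 2.\<close>

lemma sum_half_power_dist_le: "(\<Sum>j<J. (1/2::real) ^ (if i \<le> j then j - i else i - j)) \<le> 4"
proof -
  have geom: "(\<Sum>k<n. (1/2::real) ^ k) \<le> 2" for n
    by (subst sum_gp_strict) simp
  have "(\<Sum>j<J. (1/2::real) ^ (if i \<le> j then j - i else i - j))
      \<le> (\<Sum>j\<in>{..i} \<union> {i..<i + J}. (1/2) ^ (if i \<le> j then j - i else i - j))"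
    by (rule sum_mono2) auto
  also have "\<dots> \<le> (\<Sum>j\<le>i. (1/2) ^ (if i \<le> j then j - i else i - j))
      + (\<Sum>j\<in>{i..<i + J}. (1/2) ^ (if i \<le> j then j - i else i - j))"
    by (subst sum.union_inter[symmetric]) (auto intro: sum_nonneg)
  also have "(\<Sum>j\<le>i. (1/2::real) ^ (if i \<le> j then j - i else i - j)) = (\<Sum>k\<le>i. (1/2) ^ k)"
    by (rule sum.reindex_bij_witness[of _ "\<lambda>k. i - k" "\<lambda>k. i - k"]) auto
  also have "\<dots> = (\<Sum>k<Suc i. (1/2) ^ k)" by (simp add: lessThan_Suc_atMost)
  also have "(\<Sum>j\<in>{i..<i + J}. (1/2::real) ^ (if i \<le> j then j - i else i - j)) = (\<Sum>k<J. (1/2) ^ k)"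
    by (rule sum.reindex_bij_witness[of _ "\<lambda>k. k + i" "\<lambda>k. k - i"]) auto
  finally show ?thesis using geom[of "Suc i"] geom[of J] by simp
qed

subsection \<open>The torus\<close>

lemma has_sum_sum:
  fixes f :: "'i \<Rightarrow> 'b \<Rightarrow> real"
  assumes "finite I" "\<And>i. i \<in> I \<Longrightarrow> (f i has_sum g i) A"
  shows "((\<lambda>x. \<Sum>i\<in>I. f i x) has_sum (\<Sum>i\<in>I. g i)) A"
  using assms
proof (induction I rule: finite_induct)
  case empty
  show ?case by simp
next
  case (insert i I)
  then have "((\<lambda>x. f i x + (\<Sum>i\<in>I. f i x)) has_sum (g i + (\<Sum>i\<in>I. g i))) A"
    by (intro has_sum_add) auto
  then show ?case using insert by simp
qed

locale torus_model =
  fixes w :: "int \<Rightarrow> real" and L :: nat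
  assumes nonneg: "\<And>r. w r \<ge> 0"
    and symmetric: "\<And>r. w (- r) = w r"
    and lazy_bipartite: "\<And>r. even r \<Longrightarrow> r \<noteq> 0 \<Longrightarrow> w r = 0"
    and w0: "w 0 > 0"
    and first_moment: "(\<lambda>r. real_of_int \<bar>r\<bar> * w r) summable_on UNIV"
    and L_even: "even L" and L_pos: "L > 0"
begin

lemma w_summable: "w summable_on A"
proof (rule summable_on_subset)
  show "A \<subseteq> UNIV" by simp
  have "w summable_on (UNIV - {0})"
  proof (rule summable_on_comparison_test)
    show "(\<lambda>r. real_of_int \<bar>r\<bar> * w r) summable_on (UNIV - {0})"
      by (rule summable_on_subset[OF first_moment]) auto
    fix r :: int assume "r \<in> UNIV - {0}"
    then have "1 * w r \<le> real_of_int \<bar>r\<bar> * w r" by (intro mult_right_mono nonneg) auto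
    then show "w r \<le> real_of_int \<bar>r\<bar> * w r" by simp
  qed (rule nonneg)
  then have "w summable_on insert 0 (UNIV - {0})" by (rule summable_on_insert_iff[THEN iffD2])
  then show "w summable_on UNIV" by (simp add: insert_UNIV)
qed

text \<open>The periodised weight as a sum over all of \<open>\<int>\<close> weighted by this indicator: in this form double
  sums over vertices reduce to counting pairs at a given displacement.\<close>

definition cls :: "int \<Rightarrow> int \<Rightarrow> int \<Rightarrow> real" where
  "cls x y r = of_bool ((x + r) mod int L = y mod int L)"

lemma cls_range: "(x + r) mod int L = y mod int L \<longleftrightarrow> r \<in> range (\<lambda>k. y - x + k * int L)"
proof -
  have "(x + r) mod int L = y mod int L \<longleftrightarrow> int L dvd r - (y - x)"
    by (simp add: mod_eq_dvd_iff algebra_simps)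
  also have "\<dots> \<longleftrightarrow> r \<in> range (\<lambda>k. y - x + k * int L)"
    by (auto simp: dvd_def image_iff algebra_simps)
  finally show ?thesis .
qed

lemma periodised_has_sum: "((\<lambda>r. cls x y r * w r) has_sum periodised w L x y) UNIV"
proof -
  have inj: "inj (\<lambda>k. y - x + k * int L)" using L_pos by (auto simp: inj_on_def)
  have "(w has_sum infsum w (range (\<lambda>k. y - x + k * int L))) (range (\<lambda>k. y - x + k * int L))"
    by (rule has_sum_infsum[OF w_summable])
  also have "infsum w (range (\<lambda>k. y - x + k * int L)) = periodised w L x y"
    unfolding periodised_def by (subst infsum_reindex[OF inj]) (simp add: o_def)
  finally have "(w has_sum periodised w L x y) (range (\<lambda>k. y - x + k * int L))" .
  then show ?thesis
    by (rule has_sum_cong_neutral[THEN iffD1, rotated -1]) (auto simp: cls_def cls_range)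
qed

lemma periodised_nonneg: "periodised w L x y \<ge> 0"
  by (rule has_sum_nonneg[OF periodised_has_sum]) (simp add: cls_def nonneg)

lemma periodised_sym: "periodised w L x y = periodised w L y x"
proof -
  have "periodised w L x y = (\<Sum>\<^sub>\<infinity>k\<in>UNIV. w (y - x + (- k) * int L))"
    unfolding periodised_def
    by (rule infsum_reindex_bij_betw[symmetric, where g = uminus]) (rule bij_uminus)
  also have "\<dots> = periodised w L y x"
    unfolding periodised_def
    by (rule infsum_cong) (metis symmetric minus_add_distrib minus_diff_eq minus_mult_left minus_minus)
  finally show ?thesis .
qed

lemma periodised_mod_cong:
  assumes "(y - x) mod int L = (y' - x') mod int L"
  shows "periodised w L x y = periodised w L x' y'"
proof -
  have "cls x y r = cls x' y' r" for r
  proof -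
    have "int L dvd r - (y - x) \<longleftrightarrow> int L dvd r - (y' - x')"
      using assms by (metis mod_diff_right_eq mod_eq_0_iff_dvd)
    then show ?thesis by (simp add: cls_def mod_eq_dvd_iff algebra_simps)
  qed
  then show ?thesis
    using periodised_has_sum[of x y] periodised_has_sum[of x' y'] has_sum_unique by simp
qed

lemma even_mod: "even (i mod int L) \<longleftrightarrow> even i"
  using L_even by (simp add: dvd_mod_iff)

lemma mod_torus: "i mod int L \<in> torus L"
  using L_pos by (simp add: torus_def)

lemma torus_mod: "x \<in> torus L \<Longrightarrow> x mod int L = x"
  by (simp add: torus_def)

lemma periodised_single:
  assumes "\<And>r. (x + r) mod int L = y mod int L \<Longrightarrow> r \<noteq> c \<Longrightarrow> w r = 0"
  shows "periodised w L x y = cls x y c * w c"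
proof -
  have "((\<lambda>r. cls x y r * w r) has_sum cls x y c * w c) UNIV"
    by (rule has_sum_finite_neutralI[where B = "{c}"]) (use assms in \<open>auto simp: cls_def\<close>)
  then show ?thesis using periodised_has_sum has_sum_unique by blast
qed

lemma parity_of_shift: "(x + r) mod int L = y mod int L \<Longrightarrow> even r \<longleftrightarrow> (even x \<longleftrightarrow> even y)"
  using even_mod[of "x + r"] even_mod[of y] by auto

text \<open>Since \<open>L\<close> is even, all integers representing a displacement have the same
  parity. Between vertices of equal colour it is even, and there \<open>w\<close> lives only at 0:
  the diagonal weight is exactly \<open>w 0\<close>, and distinct vertices of equal colour do not
  interact.\<close>

sublocale bipartite_mdd "torus L" "periodised w L" "w 0" even
proof
  show "finite (torus L)" by (simp add: torus_def)
  show "periodised w L x y = periodised w L y x" for x y by (rule periodised_sym)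
  show "0 \<le> periodised w L x y" for x y by (rule periodised_nonneg)
  show "periodised w L x x = w 0" for x
    using periodised_single[of x x 0] lazy_bipartite parity_of_shift[of x _ x] by (auto simp: cls_def)
  show "w 0 > 0" by (rule w0)
  show "periodised w L x y = 0" if "x \<in> torus L" "y \<in> torus L" "x \<noteq> y" "even x = even y" for x y
  proof -
    have "cls x y 0 = 0" using that by (simp add: cls_def torus_mod)
    then show ?thesis
      using periodised_single[of x y 0] lazy_bipartite parity_of_shift[of x _ y] that by auto
  qed
qed

definition R where "R = infsum w UNIV"
definition K where "K = (\<Sum>\<^sub>\<infinity>r. real_of_int \<bar>r\<bar> * w r)"

text \<open>The factor in front of \<open>w r\<close> counts the pairs at displacement
  \<open>r\<close> modulo \<open>L\<close>, so row sums and boundary weights of arcs differ only in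
  how this count is estimated.\<close>

lemma sum_periodised_le:
  assumes "finite A" "finite B"
    and h: "h summable_on UNIV"
    and le: "\<And>r. (\<Sum>x\<in>A. \<Sum>y\<in>B. cls x y r) * w r \<le> h r"
  shows "(\<Sum>x\<in>A. \<Sum>y\<in>B. periodised w L x y) \<le> infsum h UNIV"
proof -
  have "((\<lambda>r. \<Sum>x\<in>A. \<Sum>y\<in>B. cls x y r * w r) has_sum (\<Sum>x\<in>A. \<Sum>y\<in>B. periodised w L x y)) UNIV"
    by (intro has_sum_sum periodised_has_sum assms(1,2))
  moreover have "(h has_sum infsum h UNIV) UNIV" by (rule has_sum_infsum[OF h])
  ultimately show ?thesis
    by (rule has_sum_mono) (use le in \<open>simp add: sum_distrib_right\<close>)
qed

lemma sum_cls:
  assumes "B \<subseteq> torus L"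
  shows "(\<Sum>y\<in>B. cls x y r) = of_bool ((x + r) mod int L \<in> B)"
proof -
  have fin: "finite B" using assms finite_V finite_subset by blast
  have "(\<Sum>y\<in>B. cls x y r) = (\<Sum>y\<in>B. if y = (x + r) mod int L then 1 else 0)"
    by (rule sum.cong) (use assms torus_mod in \<open>auto simp: cls_def\<close>)
  also have "\<dots> = of_bool ((x + r) mod int L \<in> B)" using fin by (simp add: sum.delta')
  finally show ?thesis .
qed

lemma sum_periodised_row_le: "(\<Sum>y\<in>torus L. periodised w L x y) \<le> R"
proof -
  have "(\<Sum>x\<in>{x}. \<Sum>y\<in>torus L. periodised w L x y) \<le> infsum w UNIV"
  proof (rule sum_periodised_le)
    show "(\<Sum>x\<in>{x}. \<Sum>y\<in>torus L. cls x y r) * w r \<le> w r" for r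
      by (simp only: sum_cls[OF subset_refl] mod_torus) simp
  qed (use finite_V in \<open>auto simp: w_summable\<close>)
  then show ?thesis by (simp add: R_def)
qed

lemma R_nonneg: "R \<ge> 0"
  unfolding R_def by (rule infsum_nonneg) (rule nonneg)

section \<open>Arcs and the variance of their charge\<close>

definition arc :: "int \<Rightarrow> int \<Rightarrow> int set" where
  "arc p q = (\<lambda>i. i mod int L) ` {p..<q}"

lemma arc_subset: "arc p q \<subseteq> torus L"
  unfolding arc_def using mod_torus by blast

lemma inj_mod:
  assumes "q - p \<le> int L"
  shows "inj_on (\<lambda>i. i mod int L) {p..<q}"
proof (rule inj_onI)
  fix i j assume ij: "i \<in> {p..<q}" "j \<in> {p..<q}" "i mod int L = j mod int L"
  then have "int L dvd i - j" by (simp add: mod_eq_dvd_iff)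
  moreover have "\<bar>i - j\<bar> < int L" using ij assms by auto
  ultimately show "i = j" using zdvd_not_zless[of "\<bar>i - j\<bar>" "int L"] by force
qed

lemma card_leave_le: "card {i \<in> {p..<q}. i + r \<notin> {p..<q}} \<le> nat \<bar>r\<bar>" for p q r :: int
proof (cases "r \<ge> 0")
  case True
  have "card {i \<in> {p..<q}. i + r \<notin> {p..<q}} \<le> card {q - r..<q}"
    by (rule card_mono) (use True in auto)
  then show ?thesis using True by simp
next
  case False
  have "card {i \<in> {p..<q}. i + r \<notin> {p..<q}} \<le> card {p..<p - r}"
    by (rule card_mono) (use False in auto)
  then show ?thesis using False by simp
qed

text \<open>A jump by \<open>r\<close> out of an interval must start among the
  \<open>\<bar>r\<bar>\<close> points nearest to one end, whatever the length of the interval, and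
  the first moment sums these counts. Winding around the torus can only bring the endpoint back into
  the arc.\<close>

lemma arc_boundary_weight_le:
  assumes "q - p \<le> int L"
  shows "(\<Sum>e\<in>boundary (arc p q). edge_weight (periodised w L) e) \<le> K"
proof -
  have "(\<Sum>e\<in>boundary (arc p q). edge_weight (periodised w L) e)
      \<le> (\<Sum>x\<in>arc p q. \<Sum>y\<in>torus L - arc p q. periodised w L x y)"
    by (rule boundary_weight_le[OF arc_subset])
  also have "\<dots> \<le> infsum (\<lambda>r. real_of_int \<bar>r\<bar> * w r) UNIV"
  proof (rule sum_periodised_le[OF _ _ first_moment])
    show "finite (arc p q)" by (simp add: arc_def)
    show "finite (torus L - arc p q)" using finite_V by simp
    fix r
    have "(\<Sum>x\<in>arc p q. \<Sum>y\<in>torus L - arc p q. cls x y r)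
      = (\<Sum>x\<in>arc p q. of_bool ((x + r) mod int L \<in> torus L - arc p q))"
      by (intro sum.cong refl sum_cls) auto
    also have "\<dots> = (\<Sum>i\<in>{p..<q}. of_bool ((i + r) mod int L \<in> torus L - arc p q))"
      unfolding arc_def by (subst sum.reindex[OF inj_mod[OF assms]]) (simp add: mod_add_left_eq)
    also have "\<dots> \<le> (\<Sum>i\<in>{p..<q}. of_bool (i + r \<notin> {p..<q}))"
      by (rule sum_mono) (auto simp: arc_def)
    also have "\<dots> = real (card {i \<in> {p..<q}. i + r \<notin> {p..<q}})"
      by (simp add: of_bool_def sum.If_cases Int_def)
    also have "\<dots> \<le> real_of_int \<bar>r\<bar>" using card_leave_le[of p q r] by linarith
    finally show "(\<Sum>x\<in>arc p q. \<Sum>y\<in>torus L - arc p q. cls x y r) * w r \<le> real_of_int \<bar>r\<bar> * w r"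
      by (rule mult_right_mono) (rule nonneg)
  qed
  finally show ?thesis by (simp add: K_def)
qed

text \<open>Odd \<open>k\<close> exchange the two colours. This is why \<open>automorphism\<close>
  speaks of weights only.\<close>

lemma automorphism_shift: "automorphism (\<lambda>z. (z + k) mod int L)"
  unfolding automorphism_def
proof
  let ?f = "\<lambda>z. (z + k) mod int L"
  have "inj_on ?f (torus L)"
  proof (rule inj_onI)
    fix x y assume xy: "x \<in> torus L" "y \<in> torus L" "?f x = ?f y"
    then have "(x + k - k) mod int L = (y + k - k) mod int L" by (metis mod_diff_left_eq)
    then show "x = y" using xy torus_mod by simp
  qed
  moreover have "?f ` torus L \<subseteq> torus L" using mod_torus by blast
  ultimately have "?f ` torus L = torus L" using endo_inj_surj[OF finite_V] by blast
  then show "bij_betw ?f (torus L) (torus L)" using \<open>inj_on ?f (torus L)\<close> by (simp add: bij_betw_def)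
  have "periodised w L (?f x) (?f y) = periodised w L x y" for x y
  proof (rule periodised_mod_cong)
    have "((y + k) mod int L - (x + k) mod int L) mod int L = ((y + k) - (x + k)) mod int L"
      by (simp only: mod_diff_eq)
    then show "(?f y - ?f x) mod int L = (y - x) mod int L" by simp
  qed
  then show "\<forall>x\<in>torus L. \<forall>y\<in>torus L. periodised w L (?f x) (?f y) = periodised w L x y" by blast
qed

text \<open>The charge of the integer interval from \<open>p\<close> to \<open>q\<close> in the periodic extension of \<open>U\<close>. It agrees
  with the charge of an arc only if \<open>q - p \<le> L\<close>, but is additive without that restriction.\<close>

definition S :: "int \<Rightarrow> int \<Rightarrow> int set \<Rightarrow> real" where
  "S p q U = (\<Sum>i\<in>{p..<q}. sg i * of_bool (i mod int L \<in> U))"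

lemma charge_arc:
  assumes "q - p \<le> int L" "U \<subseteq> torus L"
  shows "charge (indicator (arc p q)) U = S p q U"
proof -
  have fin: "finite U" "finite (arc p q)"
    using assms(2) finite_V finite_subset by (auto simp: arc_def)
  have "charge (indicator (arc p q)) U = (\<Sum>z\<in>U \<inter> arc p q. sg z)"
    unfolding charge_def using fin by (simp add: sum.inter_restrict indicator_def of_bool_def if_distrib cong: if_cong)
  also have "\<dots> = (\<Sum>z\<in>{z \<in> arc p q. z \<in> U}. sg z)" by (rule sum.cong) auto
  also have "\<dots> = (\<Sum>z\<in>arc p q. of_bool (z \<in> U) * sg z)"
    by (rule sum_indicator_mult[OF fin(2)])
  also have "\<dots> = S p q U"
    unfolding arc_def S_def by (subst sum.reindex[OF inj_mod[OF assms(1)]]) (simp add: sg_def even_mod mult.commute)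
  finally show ?thesis .
qed

text \<open>A translation by an odd amount reverses every sign, so it is the square that is
  invariant.\<close>

lemma S_shift:
  assumes "U \<subseteq> torus L"
  shows "(S (p + k) (q + k) ((\<lambda>z. (z + k) mod int L) ` U))\<^sup>2 = (S p q U)\<^sup>2"
proof -
  let ?f = "\<lambda>z. (z + k) mod int L"
  have mem: "(i + k) mod int L \<in> ?f ` U \<longleftrightarrow> i mod int L \<in> U" for i
  proof
    assume "i mod int L \<in> U"
    then show "(i + k) mod int L \<in> ?f ` U" by (rule rev_image_eqI) (simp add: mod_add_left_eq)
  next
    assume "(i + k) mod int L \<in> ?f ` U"
    then obtain z where z: "z \<in> U" "(i + k) mod int L = (z + k) mod int L" by blast
    then have "(i + k - k) mod int L = (z + k - k) mod int L" by (metis mod_diff_left_eq)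
    then show "i mod int L \<in> U" using z assms torus_mod by auto
  qed
  have "S (p + k) (q + k) (?f ` U) = (\<Sum>i\<in>{p..<q}. sg (i + k) * of_bool ((i + k) mod int L \<in> ?f ` U))"
    unfolding S_def by (rule sum.reindex_bij_witness[of _ "\<lambda>i. i + k" "\<lambda>i. i - k"]) auto
  also have "\<dots> = (\<Sum>i\<in>{p..<q}. (if even k then 1 else -1) * (sg i * of_bool (i mod int L \<in> U)))"
    unfolding mem by (rule sum.cong) (auto simp: sg_def)
  also have "\<dots> = (if even k then 1 else -1) * S p q U"
    unfolding S_def by (simp only: sum_distrib_left)
  finally show ?thesis by (simp add: power_mult_distrib)
qed

text \<open>By translation invariance the variance of the charge of an arc depends only on its length;
  it is again unnormalised.\<close>

definition arc_var :: "nat \<Rightarrow> real" where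
  "arc_var n = EE (\<lambda>U. (S 0 (int n) U)\<^sup>2)"

lemma EE_cong: "(\<And>U. U \<subseteq> torus L \<Longrightarrow> f U = g U) \<Longrightarrow> EE f = EE g"
  unfolding EE_def by (rule sum.cong) auto

lemma EE_S:
  assumes "q = p + int n"
  shows "EE (\<lambda>U. (S p q U)\<^sup>2) = arc_var n"
proof -
  have "EE (\<lambda>U. (S p q U)\<^sup>2) = EE (\<lambda>U. (S p q ((\<lambda>z. (z + p) mod int L) ` U))\<^sup>2)"
    by (rule EE_automorphism[OF automorphism_shift, symmetric])
  also have "\<dots> = arc_var n" unfolding arc_var_def
  proof (rule EE_cong)
    fix U assume "U \<subseteq> torus L"
    from S_shift[OF this, of 0 p "int n"] show "(S p q ((\<lambda>z. (z + p) mod int L) ` U))\<^sup>2 = (S 0 (int n) U)\<^sup>2"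
      by (simp add: assms add.commute)
  qed
  finally show ?thesis .
qed

lemma arc_var_nonneg: "arc_var n \<ge> 0"
  unfolding arc_var_def by (rule EE_nonneg) simp

definition C where "C = (K / w 0)\<^sup>2"

lemma arc_var_le:
  assumes "n \<le> L"
  shows "arc_var n \<le> C * Z"
proof -
  have "arc_var n = EE (\<lambda>U. (charge (indicator (arc 0 (int n))) U)\<^sup>2)"
    unfolding arc_var_def by (rule EE_cong) (use assms in \<open>simp add: charge_arc\<close>)
  also have "\<dots> \<le> ((\<Sum>e\<in>boundary (arc 0 (int n)). edge_weight (periodised w L) e) / w 0)\<^sup>2 * Z"
    by (rule EE_charge_le)
  also have "\<dots> \<le> C * Z" unfolding C_def
  proof (intro mult_right_mono power_mono divide_right_mono)
    show "(\<Sum>e\<in>boundary (arc 0 (int n)). edge_weight (periodised w L) e) \<le> K"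
      by (rule arc_boundary_weight_le) (use assms in simp)
    show "0 \<le> (\<Sum>e\<in>boundary (arc 0 (int n)). edge_weight (periodised w L) e) / w 0"
      using w0 by (intro divide_nonneg_pos sum_nonneg less_imp_le[OF edge_weight_pos]) (auto simp: boundary_def)
  qed (use w0 Z_pos in auto)
  finally show ?thesis .
qed

lemma S_split: "p \<le> m \<Longrightarrow> m \<le> q \<Longrightarrow> S p q U = S p m U + S m q U"
  unfolding S_def by (subst sum.union_disjoint[symmetric]) (auto simp: ivl_disj_un)

text \<open>Polarisation, using the four arcs between the endpoints of the two given ones.\<close>

lemma EE_S_S:
  assumes "n \<le> N"
  shows "EE (\<lambda>U. S (x - int n) (x + int n) U * S (x - int N) (x + int N) U) = arc_var (N + n) - arc_var (N - n)"
proof -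
  let ?A = "x - int n" and ?B = "x + int n" and ?C = "x - int N" and ?D = "x + int N"
  have "EE (\<lambda>U. S ?A ?B U * S ?C ?D U)
    = EE (\<lambda>U. 1/2 * (((S ?C ?B U)\<^sup>2 + (S ?A ?D U)\<^sup>2) - ((S ?C ?A U)\<^sup>2 + (S ?B ?D U)\<^sup>2)))"
  proof (rule EE_cong)
    fix U
    have "S ?C ?B U = S ?C ?A U + S ?A ?B U" "S ?A ?D U = S ?A ?B U + S ?B ?D U"
      "S ?C ?D U = S ?C ?A U + (S ?A ?B U + S ?B ?D U)"
      using assms S_split[of ?C ?A ?B] S_split[of ?A ?B ?D] S_split[of ?C ?A ?D] by simp_all
    then show "S ?A ?B U * S ?C ?D U
      = 1/2 * (((S ?C ?B U)\<^sup>2 + (S ?A ?D U)\<^sup>2) - ((S ?C ?A U)\<^sup>2 + (S ?B ?D U)\<^sup>2))"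
      by (simp only:) (simp add: power2_eq_square algebra_simps)
  qed
  also have "\<dots> = 1/2 * ((arc_var (N + n) + arc_var (N + n)) - (arc_var (N - n) + arc_var (N - n)))"
    unfolding EE_cmult EE_diff EE_add
    using assms EE_S[of ?B ?C "N + n"] EE_S[of ?D ?A "N + n"] EE_S[of ?A ?C "N - n"] EE_S[of ?D ?B "N - n"]
    by simp
  finally show ?thesis by simp
qed

end

section \<open>Test functions averaged over dyadic scales\<close>

lemma (in bipartite_mdd) charge_delete:
  assumes "U \<subseteq> V" "p \<in> U" "q \<in> U" "p \<noteq> q"
  shows "charge b (U - {p, q}) = charge b U - sg p * b p - sg q * b q"
proof -
  have fin: "finite U" using assms(1) finite_V finite_subset by blast
  have "U = insert p (insert q (U - {p, q}))" using assms by blast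
  then have "charge b U = charge b (insert p (insert q (U - {p, q})))" by simp
  also have "\<dots> = sg p * b p + (sg q * b q + charge b (U - {p, q}))"
    unfolding charge_def using fin assms by (subst sum.insert; simp)+
  finally show ?thesis by simp
qed

context torus_model
begin

text \<open>A discrete tent of height 1 at \<open>x\<close>, presented as a mean of indicators so
  that its charge is a mean of arc charges. The half-open arc of radius \<open>N\<close> has length
  \<open>2 * N\<close>.\<close>

definition tent :: "int \<Rightarrow> nat \<Rightarrow> int \<Rightarrow> real" where
  "tent x j z = (\<Sum>N\<in>{1..2 ^ j}. (1/2) ^ j * indicator (arc (x - int N) (x + int N)) z)"

lemma charge_tent:
  assumes "2 ^ Suc j \<le> L" "U \<subseteq> torus L"
  shows "charge (tent x j) U = (\<Sum>N\<in>{1..2 ^ j}. (1/2) ^ j * S (x - int N) (x + int N) U)"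
proof -
  have "charge (tent x j) U = (\<Sum>N\<in>{1..2 ^ j}. (1/2) ^ j * charge (indicator (arc (x - int N) (x + int N))) U)"
    unfolding tent_def[abs_def] charge_sum charge_cmult ..
  also have "\<dots> = (\<Sum>N\<in>{1..2 ^ j}. (1/2) ^ j * S (x - int N) (x + int N) U)"
  proof (rule sum.cong[OF refl])
    fix N :: nat assume "N \<in> {1..2 ^ j}"
    then have "2 * N \<le> L" using assms(1) by simp
    then have "x + int N - (x - int N) \<le> int L" by simp
    then show "(1/2) ^ j * charge (indicator (arc (x - int N) (x + int N))) U
        = (1/2) ^ j * S (x - int N) (x + int N) U"
      using charge_arc assms(2) by simp
  qed
  finally show ?thesis .
qed

lemma EE_S_S':
  "EE (\<lambda>U. S (x - int n) (x + int n) U * S (x - int N) (x + int N) U)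
    = arc_var (N + n) - arc_var (if n \<le> N then N - n else n - N)"
proof (cases "n \<le> N")
  case True
  then show ?thesis using EE_S_S[of n N x] by simp
next
  case False
  then show ?thesis using EE_S_S[of N n x] by (simp add: mult.commute add.commute)
qed

text \<open>For a fixed radius \<open>n\<close> the covariances with all radii \<open>N\<close>
  telescope to at most \<open>2 * n * (C * Z)\<close>. Averaging over the \<open>2 ^ j\<close>
  values of \<open>N\<close> leaves a factor of order \<open>n / 2 ^ j\<close>, where
  \<open>n \<le> 2 ^ i\<close>. The bound on \<open>2 ^ Suc j\<close> keeps \<open>N + n\<close> in
  the range of \<open>arc_var_le\<close>.\<close>

lemma EE_tent_tent_aux:
  assumes "i \<le> j" "2 ^ Suc j \<le> L"
  shows "EE (\<lambda>U. charge (tent x i) U * charge (tent x j) U) \<le> 2 * (C * Z) * (1/2) ^ (j - i)"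
proof -
  let ?T = "\<lambda>N U. S (x - int N) (x + int N) U"
  have ij: "(2::nat) ^ i \<le> 2 ^ j" using assms(1) by simp
  then have "2 ^ Suc i \<le> L" using assms(2) by (metis le_trans mult_le_mono2 power_Suc)
  then have "EE (\<lambda>U. charge (tent x i) U * charge (tent x j) U)
    = EE (\<lambda>U. \<Sum>n\<in>{1..2 ^ i}. \<Sum>N\<in>{1..2 ^ j}. (1/2) ^ i * (1/2) ^ j * (?T n U * ?T N U))"
    by (intro EE_cong) (simp only: charge_tent assms(2) sum_product mult_ac)
  also have "\<dots> = (\<Sum>n\<in>{1..2 ^ i}. \<Sum>N\<in>{1..2 ^ j}. (1/2) ^ i * (1/2) ^ j *
      (arc_var (N + n) - arc_var (if n \<le> N then N - n else n - N)))"
    by (simp only: EE_sum EE_cmult EE_S_S')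
  also have "\<dots> = (\<Sum>n\<in>{1..2 ^ i}. (1/2) ^ i * (1/2) ^ j *
      (\<Sum>N\<in>{1..2 ^ j}. arc_var (N + n) - arc_var (if n \<le> N then N - n else n - N)))"
    by (simp only: sum_distrib_left)
  also have "\<dots> \<le> (\<Sum>n\<in>{1..2 ^ i::nat}. (1/2) ^ i * (1/2) ^ j * (2 * 2 ^ i * (C * Z)))"
  proof (intro sum_mono mult_left_mono)
    fix n :: nat assume n: "n \<in> {1..2 ^ i}"
    then have nj: "n \<le> 2 ^ j" using ij by (meson atLeastAtMost_iff le_trans)
    have "(\<Sum>N\<in>{1..2 ^ j}. arc_var (N + n) - arc_var (if n \<le> N then N - n else n - N)) \<le> 2 * real n * (C * Z)"
    proof (rule sum_telescope_le[OF arc_var_nonneg _ nj])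
      fix k assume "k \<le> n + 2 ^ j"
      then have "k \<le> L" using nj assms(2) by simp
      then show "arc_var k \<le> C * Z" by (rule arc_var_le)
    qed
    also have "\<dots> \<le> 2 * 2 ^ i * (C * Z)"
    proof (intro mult_right_mono mult_left_mono)
      show "real n \<le> 2 ^ i" using n by (metis atLeastAtMost_iff of_nat_le_iff of_nat_numeral of_nat_power)
      show "0 \<le> C * Z" using Z_pos by (simp add: C_def)
    qed simp
    finally show "(\<Sum>N\<in>{1..2 ^ j}. arc_var (N + n) - arc_var (if n \<le> N then N - n else n - N)) \<le> 2 * 2 ^ i * (C * Z)" .
  qed simp
  also have "\<dots> = 2 * (C * Z) * (2 ^ i * (1/2) ^ j)" by (simp add: power_one_over)
  also have "2 ^ i * (1/2) ^ j = (1/2::real) ^ (j - i)"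
    using assms(1) by (simp add: power_diff power_one_over field_simps)
  finally show ?thesis .
qed

lemma EE_tent_tent:
  assumes "2 ^ Suc i \<le> L" "2 ^ Suc j \<le> L"
  shows "EE (\<lambda>U. charge (tent x i) U * charge (tent x j) U)
    \<le> 2 * (C * Z) * (1/2) ^ (if i \<le> j then j - i else i - j)"
proof (cases "i \<le> j")
  case True
  then show ?thesis using EE_tent_tent_aux[OF True assms(2), of x] by simp
next
  case False
  then show ?thesis using EE_tent_tent_aux[of j i x] assms(1) by (simp add: mult.commute)
qed

text \<open>The averages over different dyadic scales are nearly uncorrelated, so averaging them once
  more over \<open>J\<close> scales yields a function of height \<open>1\<close> at \<open>x\<close> whose charge has second moment
  \<open>O(1/J)\<close>.\<close>

definition probe :: "int \<Rightarrow> nat \<Rightarrow> int \<Rightarrow> real" where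
  "probe x J z = (\<Sum>j<J. 1 / real J * tent x j z)"

text \<open>Decay in the distance of scales bounds each of the \<open>J\<close> rows of the
  covariance matrix by \<open>4 * 2 * (C * Z)\<close>, against the normalisation
  \<open>1 / J ^ 2\<close>. The longest arc involved has length \<open>2 ^ J\<close>.\<close>

lemma EE_probe_le:
  assumes "J > 0" "2 ^ J \<le> L"
  shows "EE (\<lambda>U. (charge (probe x J) U)\<^sup>2) \<le> 8 * C / real J * Z"
proof -
  have scale: "2 ^ Suc j \<le> L" if "j < J" for j
  proof -
    have "(2::nat) ^ Suc j \<le> 2 ^ J" using that by (intro power_increasing) auto
    then show ?thesis using assms(2) by linarith
  qed
  have "EE (\<lambda>U. (charge (probe x J) U)\<^sup>2) = (\<Sum>i<J. \<Sum>j<J. 1 / real J * (1 / real J) *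
      EE (\<lambda>U. charge (tent x i) U * charge (tent x j) U))"
    unfolding probe_def[abs_def] charge_sum charge_cmult EE_square_sum EE_cmult[symmetric]
    by (simp only: mult_ac)
  also have "\<dots> \<le> (\<Sum>i<J. \<Sum>j<J. 1 / real J * (1 / real J) *
      (2 * (C * Z) * (1/2) ^ (if i \<le> j then j - i else i - j)))"
    by (intro sum_mono mult_left_mono EE_tent_tent scale) auto
  also have "\<dots> = 1 / real J * (1 / real J) * (2 * (C * Z)) *
      (\<Sum>i<J. \<Sum>j<J. (1/2) ^ (if i \<le> j then j - i else i - j))"
    by (simp only: sum_distrib_left mult.assoc)
  also have "\<dots> \<le> 1 / real J * (1 / real J) * (2 * (C * Z)) * (\<Sum>i<J. 4)"
    using Z_pos by (intro mult_left_mono sum_mono sum_half_power_dist_le) (simp add: C_def)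
  also have "\<dots> = 8 * C / real J * Z" using assms(1) by (simp add: field_simps)
  finally show ?thesis .
qed

lemma tent_center:
  assumes "x \<in> torus L"
  shows "tent x j x = 1"
proof -
  have "x \<in> arc (x - int N) (x + int N)" if "N \<ge> 1" for N
    unfolding arc_def by (rule image_eqI[of _ _ x]) (use that torus_mod[OF assms] in auto)
  then have "tent x j x = (\<Sum>N\<in>{1..2 ^ j::nat}. (1/2) ^ j)"
    unfolding tent_def by (intro sum.cong) auto
  then show ?thesis by (simp add: power_one_over)
qed

lemma tent_outside:
  assumes "z \<notin> arc (x - 2 ^ J) (x + 2 ^ J)" "j < J"
  shows "tent x j z = 0"
  unfolding tent_def
proof (rule sum.neutral, rule ballI)
  fix N :: nat assume N: "N \<in> {1..2 ^ j}"
  have "(2::nat) ^ j \<le> 2 ^ J" using assms(2) by (intro power_increasing) auto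
  with N have "N \<le> 2 ^ J" by (meson atLeastAtMost_iff le_trans)
  then have "int N \<le> 2 ^ J" by (metis of_nat_le_iff of_nat_numeral of_nat_power)
  then have "arc (x - int N) (x + int N) \<subseteq> arc (x - 2 ^ J) (x + 2 ^ J)"
    unfolding arc_def by (intro image_mono) auto
  then show "(1/2) ^ j * indicator (arc (x - int N) (x + int N)) z = (0::real)"
    using assms(1) by (auto simp: indicator_def)
qed

lemma probe_center: "x \<in> torus L \<Longrightarrow> J > 0 \<Longrightarrow> probe x J x = 1"
  by (simp add: probe_def tent_center)

lemma probe_outside: "z \<notin> arc (x - 2 ^ J) (x + 2 ^ J) \<Longrightarrow> probe x J z = 0"
  by (simp add: probe_def tent_outside)

lemma probe_nonneg: "probe x J z \<ge> 0"
  unfolding probe_def tent_def by (intro sum_nonneg mult_nonneg_nonneg) auto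

lemma card_arc_le: "real (card (arc (x - 2 ^ J) (x + 2 ^ J))) \<le> 2 * 2 ^ J"
proof -
  have "card (arc (x - 2 ^ J) (x + 2 ^ J)) \<le> card {x - 2 ^ J..<x + 2 ^ J}"
    unfolding arc_def by (rule card_image_le) simp
  also have "\<dots> = nat (2 * 2 ^ J)" by simp
  finally have "int (card (arc (x - 2 ^ J) (x + 2 ^ J))) \<le> 2 * 2 ^ J"
    using le_nat_iff[of "2 * 2 ^ J" "card (arc (x - 2 ^ J) (x + 2 ^ J))"] by simp
  then have "real_of_int (int (card (arc (x - 2 ^ J) (x + 2 ^ J)))) \<le> real_of_int (2 * 2 ^ J)"
    by (simp only: of_int_le_iff)
  then show ?thesis by simp
qed

section \<open>Bounds on the torus at a fixed number of scales\<close>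

definition err :: "nat \<Rightarrow> real \<Rightarrow> real" where
  "err J t = 8 * C / (real J * t) + t"

lemma overlap_le_err:
  assumes "J > 0" "2 ^ J \<le> L" "t > 0" "A \<subseteq> torus L" "B \<subseteq> torus L"
    and "\<And>U. A \<subseteq> U \<Longrightarrow> B \<subseteq> U \<Longrightarrow> U \<subseteq> torus L \<Longrightarrow>
      1 \<le> \<bar>charge (probe x J) (U - A) - charge (probe x J) (U - B)\<bar>"
  shows "overlap A B \<le> ((1 / w 0) ^ card A + (1 / w 0) ^ card B) / 2 * (err J t * Z)"
proof -
  have "overlap A B \<le> ((1 / w 0) ^ card A + (1 / w 0) ^ card B) / 2 *
      (EE (\<lambda>U. (charge (probe x J) U)\<^sup>2) / t + t * Z)"
    by (rule overlap_le_shift[OF assms(4,5,3)]) (rule assms(6))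
  also have "\<dots> \<le> ((1 / w 0) ^ card A + (1 / w 0) ^ card B) / 2 * (8 * C / real J * Z / t + t * Z)"
    using w0 \<open>t > 0\<close> EE_probe_le[OF assms(1,2)]
    by (intro mult_left_mono add_right_mono divide_right_mono) auto
  also have "8 * C / real J * Z / t + t * Z = err J t * Z"
    by (simp add: err_def field_simps)
  finally show ?thesis .
qed

lemma err_nonneg: "t > 0 \<Longrightarrow> err J t \<ge> 0"
  by (simp add: err_def C_def)

text \<open>\<open>x\<close> and \<open>u\<close> have opposite signs and are deleted on different
  sides of the comparison, so their effects add up to \<open>1 + probe x J u\<close>, wherever
  \<open>u\<close> lies. Only \<open>y\<close> and \<open>v\<close> could cancel the shift, and only
  inside the support of the probe; there the crude bound \<open>overlap_le\<close> is paid
  instead.\<close>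

lemma overlap_cuts_le:
  assumes J: "J > 0" "2 ^ J \<le> L" "t > 0" and xy: "(x, y) \<in> bichrom" and uv: "(u, v) \<in> cuts x y"
  defines "I \<equiv> arc (x - 2 ^ J) (x + 2 ^ J)"
  shows "overlap {x, y} {u, v} \<le> (1 / w 0)\<^sup>2 * Z * (err J t + of_bool (y \<in> I) + of_bool (v \<in> I))"
proof -
  have V: "x \<in> torus L" "y \<in> torus L" "u \<in> torus L" "v \<in> torus L"
    and col: "even x" "odd y" "odd u" "even v"
    using xy uv by (auto simp: bichrom_def cuts_def)
  have ne: "x \<noteq> y" "u \<noteq> v" using col by auto
  have pos: "(1 / w 0)\<^sup>2 * Z \<ge> 0" using Z_pos by simp
  show ?thesis
  proof (cases "y \<in> I \<or> v \<in> I")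
    case True
    have "overlap {x, y} {u, v} \<le> (1 / w 0)\<^sup>2 * Z * 1"
      using overlap_le[of "{x, y}" "{u, v}"] V ne by (simp add: power2_eq_square)
    also have "\<dots> \<le> (1 / w 0)\<^sup>2 * Z * (err J t + of_bool (y \<in> I) + of_bool (v \<in> I))"
      using True err_nonneg[OF J(3), of J] by (intro mult_left_mono pos) auto
    finally show ?thesis .
  next
    case False
    have "overlap {x, y} {u, v} \<le> ((1 / w 0) ^ card {x, y} + (1 / w 0) ^ card {u, v}) / 2 * (err J t * Z)"
    proof (rule overlap_le_err[OF J])
      fix U assume U: "{x, y} \<subseteq> U" "{u, v} \<subseteq> U" "U \<subseteq> torus L"
      have "charge (probe x J) (U - {x, y}) - charge (probe x J) (U - {u, v}) = - (1 + probe x J u)"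
        using charge_delete[of U x y "probe x J"] charge_delete[of U u v "probe x J"] U ne False
        by (simp add: sg_def col probe_center V J probe_outside I_def)
      then show "1 \<le> \<bar>charge (probe x J) (U - {x, y}) - charge (probe x J) (U - {u, v})\<bar>"
        using probe_nonneg[of x J u] by simp
    qed (use V in auto)
    then show ?thesis using False ne by (simp add: power2_eq_square mult_ac)
  qed
qed

lemma overlap_empty_le:
  assumes J: "J > 0" "2 ^ J \<le> L" "t > 0" and xy: "x \<in> torus L" "y \<in> torus L" "x \<noteq> y"
  defines "I \<equiv> arc (x - 2 ^ J) (x + 2 ^ J)"
  shows "overlap {x, y} {} \<le> ((1 / w 0)\<^sup>2 + 1) / 2 * Z * (err J t + of_bool (y \<in> I))"
proof -
  have pos: "((1 / w 0)\<^sup>2 + 1) / 2 * Z \<ge> 0" using Z_pos by simp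
  show ?thesis
  proof (cases "y \<in> I")
    case True
    have "overlap {x, y} {} \<le> ((1 / w 0)\<^sup>2 + 1) / 2 * Z * 1"
      using overlap_le[of "{x, y}" "{}"] xy by (simp add: power2_eq_square)
    also have "\<dots> \<le> ((1 / w 0)\<^sup>2 + 1) / 2 * Z * (err J t + of_bool (y \<in> I))"
      using True err_nonneg[OF J(3), of J] by (intro mult_left_mono pos) auto
    finally show ?thesis .
  next
    case False
    have "overlap {x, y} {} \<le> ((1 / w 0) ^ card {x, y} + (1 / w 0) ^ card ({} :: int set)) / 2 * (err J t * Z)"
    proof (rule overlap_le_err[OF J])
      fix U assume U: "{x, y} \<subseteq> U" "U \<subseteq> torus L"
      have "charge (probe x J) (U - {x, y}) - charge (probe x J) (U - {}) = - sg x"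
        using charge_delete[of U x y "probe x J"] U xy False
        by (simp add: probe_center J probe_outside I_def)
      then show "1 \<le> \<bar>charge (probe x J) (U - {x, y}) - charge (probe x J) (U - {})\<bar>"
        by (simp add: sg_def)
    qed (use xy in auto)
    then show ?thesis using False xy by (simp add: power2_eq_square mult_ac)
  qed
qed

lemma card_torus: "card (torus L) = L"
  by (simp add: torus_def)

lemma mdd_G_nonneg: "x \<in> torus L \<Longrightarrow> y \<in> torus L \<Longrightarrow> mdd_G (torus L) (periodised w L) x y \<ge> 0"
  using overlap_nonneg[of "{x, y}" "{}"] Z_pos
  by (cases "x = y") (auto simp: mdd_G_eq, simp add: mdd_G_def)

lemma torus_M_nonneg: "torus_M w L \<ge> 0"
  unfolding torus_M_def using L_pos
  by (intro mult_nonneg_nonneg sum_nonneg mdd_G_nonneg) (auto simp: torus_def)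

lemma torus_M_le:
  assumes J: "J > 0" "2 ^ J \<le> L" "t > 0"
  shows "torus_M w L \<le> ((1 / w 0)\<^sup>2 + 1) / 2 * (err J t + 2 * 2 ^ J / real L)"
proof -
  let ?c = "((1 / w 0)\<^sup>2 + 1) / 2" and ?I = "arc (0 - 2 ^ J) (0 + 2 ^ J)"
  have zero: "0 \<in> torus L" using L_pos by (simp add: torus_def)
  have "mdd_G (torus L) (periodised w L) 0 y \<le> ?c * (err J t + of_bool (y \<in> ?I))" if "y \<in> torus L" for y
  proof (cases "0 = y")
    case True
    then show ?thesis using err_nonneg[OF J(3), of J] by (simp add: mdd_G_def)
  next
    case False
    then show ?thesis
      using overlap_empty_le[OF J zero that False] unfolding mdd_G_eq[OF zero that False]
      by (simp only: pos_divide_le_eq[OF Z_pos] mult_ac)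
  qed
  then have "(\<Sum>y\<in>torus L. mdd_G (torus L) (periodised w L) 0 y)
      \<le> (\<Sum>y\<in>torus L. ?c * (err J t + of_bool (y \<in> ?I)))"
    by (rule sum_mono)
  also have "\<dots> = ?c * (real L * err J t + (\<Sum>y\<in>torus L. of_bool (y \<in> ?I)))"
    unfolding sum_distrib_left[symmetric] sum.distrib by (simp add: card_torus)
  also have "(\<Sum>y\<in>torus L. of_bool (y \<in> ?I)) = real (card ?I)"
    using arc_subset[of "0 - 2 ^ J" "0 + 2 ^ J"] finite_V
    by (simp add: of_bool_def sum.If_cases Int_absorb1)
  also have "?c * (real L * err J t + real (card ?I)) \<le> ?c * (real L * err J t + 2 * 2 ^ J)"
    using card_arc_le[of 0 J] by (intro mult_left_mono add_left_mono) auto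
  finally have "torus_M w L \<le> 1 / real L * (?c * (real L * err J t + 2 * 2 ^ J))"
    unfolding torus_M_def by (intro mult_left_mono) auto
  also have "\<dots> = ?c * (err J t + 2 * 2 ^ J / real L)" using L_pos by (simp add: field_simps)
  finally show ?thesis .
qed

text \<open>The sum over \<open>u\<close> costs a factor \<open>R\<close>. Among the remaining
  terms, \<open>y\<close> near \<open>x\<close> and \<open>v\<close> near \<open>x\<close> each
  admit at most \<open>2 * 2 ^ J\<close> positions, which gives \<open>4 * 2 ^ J\<close>; for
  \<open>v\<close> the sum over \<open>y\<close> is taken first, using the symmetry of the
  weights.\<close>

lemma sum_cuts_le:
  assumes J: "J > 0" "2 ^ J \<le> L" "t > 0"
  shows "(\<Sum>(x, y)\<in>bichrom. \<Sum>(u, v)\<in>cuts x y. periodised w L x u * periodised w L y v * overlap {x, y} {u, v})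
    \<le> (1 / w 0)\<^sup>2 * Z * R\<^sup>2 * (real L * (real L * err J t + 4 * 2 ^ J))"
proof -
  let ?W = "periodised w L" and ?V = "torus L" and ?I = "\<lambda>x. arc (x - 2 ^ J) (x + 2 ^ J)"
  let ?g = "\<lambda>x y v. err J t + of_bool (y \<in> ?I x) + of_bool (v \<in> ?I x)"
  let ?c = "(1 / w 0)\<^sup>2 * Z"
  have c: "?c \<ge> 0" using Z_pos by simp
  have g: "?g x y v \<ge> 0" for x y v using err_nonneg[OF J(3), of J] by simp
  have inner: "(\<Sum>(u, v)\<in>cuts x y. ?W x u * ?W y v * overlap {x, y} {u, v})
      \<le> ?c * R * (\<Sum>v\<in>?V. ?W y v * ?g x y v)" if xy: "(x, y) \<in> bichrom" for x y
  proof -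
    have "(\<Sum>(u, v)\<in>cuts x y. ?W x u * ?W y v * overlap {x, y} {u, v})
      \<le> (\<Sum>(u, v)\<in>cuts x y. ?W x u * ?W y v * (?c * ?g x y v))"
      using overlap_cuts_le[OF J xy] periodised_nonneg by (intro sum_mono) (auto intro!: mult_left_mono)
    also have "\<dots> \<le> (\<Sum>(u, v)\<in>?V \<times> ?V. ?W x u * ?W y v * (?c * ?g x y v))"
    proof (rule sum_mono2)
      show "0 \<le> (case p of (u, v) \<Rightarrow> ?W x u * ?W y v * (?c * ?g x y v))" for p
        by (cases p) (simp only: prod.case, intro mult_nonneg_nonneg periodised_nonneg g
          zero_le_power2 less_imp_le[OF Z_pos])
    qed (use finite_V in \<open>auto simp: cuts_def\<close>)
    also have "\<dots> = (\<Sum>u\<in>?V. ?W x u) * (?c * (\<Sum>v\<in>?V. ?W y v * ?g x y v))"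
      unfolding sum.cartesian_product[symmetric] sum_distrib_left[of ?c] sum_product
      by (simp only: mult_ac)
    also have "\<dots> \<le> R * (?c * (\<Sum>v\<in>?V. ?W y v * ?g x y v))"
      by (intro mult_right_mono sum_periodised_row_le mult_nonneg_nonneg sum_nonneg periodised_nonneg g
        zero_le_power2 less_imp_le[OF Z_pos])
    finally show ?thesis by (simp only: mult_ac)
  qed
  have row: "(\<Sum>y\<in>?V. \<Sum>v\<in>?V. ?W y v * ?g x y v) \<le> R * (real L * err J t + 4 * 2 ^ J)" for x
  proof -
    have fin: "finite (?I x)" by (simp add: arc_def)
    have cI: "(\<Sum>y\<in>?V. of_bool (y \<in> ?I x) * R) \<le> 2 * 2 ^ J * R"
    proof -
      have "(\<Sum>y\<in>?V. of_bool (y \<in> ?I x) * R) = (\<Sum>y\<in>{y \<in> ?V. y \<in> ?I x}. R)"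
        by (rule sum_indicator_mult[symmetric]) (rule finite_V)
      also have "{y \<in> ?V. y \<in> ?I x} = ?I x" using arc_subset by blast
      also have "(\<Sum>y\<in>?I x. R) = real (card (?I x)) * R" by simp
      also have "\<dots> \<le> 2 * 2 ^ J * R" by (intro mult_right_mono card_arc_le R_nonneg)
      finally show ?thesis .
    qed
    have "(\<Sum>y\<in>?V. \<Sum>v\<in>?V. ?W y v * ?g x y v)
      = (\<Sum>y\<in>?V. err J t * (\<Sum>v\<in>?V. ?W y v)) + (\<Sum>y\<in>?V. of_bool (y \<in> ?I x) * (\<Sum>v\<in>?V. ?W y v))
        + (\<Sum>y\<in>?V. \<Sum>v\<in>?V. of_bool (v \<in> ?I x) * ?W y v)"
      unfolding sum_distrib_left sum.distrib[symmetric] by (simp only: distrib_left mult_ac)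
    also have "(\<Sum>y\<in>?V. \<Sum>v\<in>?V. of_bool (v \<in> ?I x) * ?W y v)
      = (\<Sum>v\<in>?V. of_bool (v \<in> ?I x) * (\<Sum>y\<in>?V. ?W v y))"
      unfolding sum_distrib_left by (subst sum.swap) (simp only: periodised_sym)
    also have "(\<Sum>y\<in>?V. err J t * (\<Sum>v\<in>?V. ?W y v)) + (\<Sum>y\<in>?V. of_bool (y \<in> ?I x) * (\<Sum>v\<in>?V. ?W y v))
        + (\<Sum>v\<in>?V. of_bool (v \<in> ?I x) * (\<Sum>y\<in>?V. ?W v y))
      \<le> (\<Sum>y\<in>?V. err J t * R) + (\<Sum>y\<in>?V. of_bool (y \<in> ?I x) * R) + (\<Sum>y\<in>?V. of_bool (y \<in> ?I x) * R)"
      using err_nonneg[OF J(3), of J]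
      by (intro add_mono sum_mono mult_left_mono sum_periodised_row_le) auto
    also have "\<dots> \<le> real L * (err J t * R) + 2 * 2 ^ J * R + 2 * 2 ^ J * R"
      using cI by (intro add_mono) (simp_all add: card_torus)
    finally show ?thesis by (simp add: algebra_simps)
  qed
  have "(\<Sum>(x, y)\<in>bichrom. \<Sum>(u, v)\<in>cuts x y. ?W x u * ?W y v * overlap {x, y} {u, v})
    \<le> (\<Sum>(x, y)\<in>bichrom. ?c * R * (\<Sum>v\<in>?V. ?W y v * ?g x y v))"
    using inner by (intro sum_mono) auto
  also have "\<dots> \<le> (\<Sum>(x, y)\<in>?V \<times> ?V. ?c * R * (\<Sum>v\<in>?V. ?W y v * ?g x y v))"
  proof (rule sum_mono2)
    show "0 \<le> (case p of (x, y) \<Rightarrow> ?c * R * (\<Sum>v\<in>?V. ?W y v * ?g x y v))" for p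
      by (cases p) (simp only: prod.case, intro mult_nonneg_nonneg sum_nonneg periodised_nonneg g
        R_nonneg zero_le_power2 less_imp_le[OF Z_pos])
  qed (use finite_V in \<open>auto simp: bichrom_def\<close>)
  also have "\<dots> = (\<Sum>x\<in>?V. ?c * R * (\<Sum>y\<in>?V. \<Sum>v\<in>?V. ?W y v * ?g x y v))"
    by (simp only: sum.cartesian_product[symmetric] sum_distrib_left)
  also have "\<dots> \<le> (\<Sum>x\<in>?V. ?c * R * (R * (real L * err J t + 4 * 2 ^ J)))"
    using c R_nonneg row by (intro sum_mono mult_left_mono) auto
  also have "\<dots> = ?c * R\<^sup>2 * (real L * (real L * err J t + 4 * 2 ^ J))"
    by (simp add: card_torus power2_eq_square)
  finally show ?thesis .
qed

definition ELmax :: real where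
  "ELmax = (\<integral>\<omega>. real (torus_Lmax w L \<omega>) \<partial>torus_mdd w L)"

text \<open>Counting pairs controls the second moment, hence the passage to squares. After division
  by the square of \<open>L\<close> only \<open>err\<close> survives as \<open>L\<close> grows with
  \<open>J\<close> fixed.\<close>

lemma ELmax_square_le:
  assumes J: "J > 0" "2 ^ J \<le> L" "t > 0"
  shows "(1 / real L * ELmax)\<^sup>2 \<le> 4 * (R / w 0)\<^sup>2 * err J t + (4 + 16 * (R / w 0)\<^sup>2 * 2 ^ J) / real L"
proof -
  have ne: "torus L \<noteq> {}" using mod_torus[of 0] by blast
  have "ELmax\<^sup>2 \<le> (\<integral>\<omega>. (real (torus_Lmax w L \<omega>))\<^sup>2 \<partial>torus_mdd w L)"
    unfolding ELmax_def torus_mdd_def by (rule integral_mdd_square)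
  also have "\<dots> = (\<Sum>\<omega>\<in>mdd_configs (torus L) (periodised w L).
      config_weight (torus L) (periodised w L) (torus L) \<omega> * (real (torus_Lmax w L \<omega>))\<^sup>2) / Z"
    unfolding torus_mdd_def integral_mdd prw_def by (simp add: sum_divide_distrib)
  also have "\<dots> \<le> (4 * (real L * Z + (1 / w 0)\<^sup>2 * Z * R\<^sup>2 * (real L * (real L * err J t + 4 * 2 ^ J)))) / Z"
  proof (rule divide_right_mono)
    show "0 \<le> Z" using Z_pos by simp
    show "(\<Sum>\<omega>\<in>mdd_configs (torus L) (periodised w L).
        config_weight (torus L) (periodised w L) (torus L) \<omega> * (real (torus_Lmax w L \<omega>))\<^sup>2)
      \<le> 4 * (real L * Z + (1 / w 0)\<^sup>2 * Z * R\<^sup>2 * (real L * (real L * err J t + 4 * 2 ^ J)))"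
      unfolding torus_Lmax_def using sum_max_loop_length_sq_le[OF ne, unfolded card_torus]
      by (rule order_trans) (intro mult_left_mono add_left_mono sum_cuts_le[OF J], simp)
  qed
  also have "\<dots> = 4 * (real L + (R / w 0)\<^sup>2 * (real L * (real L * err J t + 4 * 2 ^ J)))"
    using Z_pos by (simp add: field_simps power2_eq_square)
  finally have "ELmax\<^sup>2 / (real L)\<^sup>2 \<le> \<dots> / (real L)\<^sup>2"
    by (rule divide_right_mono) simp
  also have "\<dots> = 4 * (R / w 0)\<^sup>2 * err J t + (4 + 16 * (R / w 0)\<^sup>2 * 2 ^ J) / real L"
  proof -
    define q where "q = (R / w 0)\<^sup>2"
    show ?thesis unfolding q_def[symmetric] using L_pos by (simp add: field_simps power2_eq_square)
  qed
  finally show ?thesis by (simp add: power_divide)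
qed

lemma torus_loop_le_Lmax: "torus_loop w L 0 \<omega> \<le> torus_Lmax w L \<omega>"
  unfolding torus_loop_def torus_Lmax_def max_loop_length_def
  using finite_V L_pos by (intro Max_ge) (auto simp: torus_def)

lemma torus_loop_expectation_le:
  "(\<integral>\<omega>. real (torus_loop w L 0 \<omega>) \<partial>torus_mdd w L) \<le> ELmax"
  unfolding ELmax_def torus_mdd_def by (rule integral_mdd_mono) (simp add: torus_loop_le_Lmax)

lemma torus_Lmax_markov:
  assumes "\<epsilon> > 0"
  shows "measure (torus_mdd w L) {\<omega> \<in> space (torus_mdd w L). real (torus_Lmax w L \<omega>) \<ge> \<epsilon> * real L}
    \<le> 1 / \<epsilon> * (1 / real L * ELmax)"
  using markov_mdd[of "\<epsilon> * real L" "\<lambda>\<omega>. real (torus_Lmax w L \<omega>)"] assms L_pos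
  unfolding ELmax_def torus_mdd_def by simp

end

section \<open>Passage to the limit\<close>

lemma eventually_even_at_top:
  "eventually P even_at_top \<longleftrightarrow> (\<exists>N. \<forall>L\<ge>N. even L \<longrightarrow> P L)"
  by (simp add: eventually_inf_principal eventually_sequentially)

text \<open>The order of the choices matters: first \<open>t\<close>, then \<open>J\<close> at least
  \<open>c / t ^ 2\<close> so that \<open>c / (J * t)\<close> is at most \<open>t\<close>, and
  \<open>L\<close> last. Hence \<open>B\<close> may depend on \<open>J\<close> in any way, and
  \<open>2 ^ J \<le> L\<close> holds eventually.\<close>

lemma tendsto_zero_even_at_top:
  fixes f :: "nat \<Rightarrow> real"
  assumes nn: "\<And>L. even L \<Longrightarrow> L > 0 \<Longrightarrow> 0 \<le> f L"
    and le: "\<And>L J t. even L \<Longrightarrow> L > 0 \<Longrightarrow> J > 0 \<Longrightarrow> 2 ^ J \<le> L \<Longrightarrow> t > 0 \<Longrightarrow>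
      f L \<le> A * (c / (real J * t) + t) + B J / real L"
    and "A \<ge> 0" "c \<ge> 0"
  shows "(f \<longlongrightarrow> 0) even_at_top"
proof (rule tendstoI)
  fix e :: real assume "e > 0"
  \<comment> \<open>The bracket will be at most \<open>2 * t\<close>, so this leaves
    \<open>e / 2\<close> for the term with \<open>B J\<close>; the \<open>+ 1\<close> covers
    \<open>A = 0\<close>.\<close>
  define t where "t = e / (4 * (A + 1))"
  have t: "t > 0" unfolding t_def using \<open>e > 0\<close> \<open>A \<ge> 0\<close> by simp
  obtain J' where J': "c / t\<^sup>2 < real J'" using reals_Archimedean2 by blast
  define J where "J = Suc J'"
  have "c / t\<^sup>2 \<le> real J" "J > 0" using J' by (auto simp: J_def)
  then have "c / (real J * t) \<le> t" using t by (simp add: field_simps power2_eq_square)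
  then have "A * (c / (real J * t) + t) \<le> A * (2 * t)" using \<open>A \<ge> 0\<close> by (intro mult_left_mono) auto
  also have "\<dots> \<le> (A + 1) * (2 * t)" using t by simp
  also have "\<dots> = e / 2" unfolding t_def using \<open>A \<ge> 0\<close> by (simp add: field_simps)
  finally have half: "A * (c / (real J * t) + t) \<le> e / 2" .
  obtain N where N: "2 * \<bar>B J\<bar> / e < real N" using reals_Archimedean2 by blast
  show "eventually (\<lambda>L. dist (f L) 0 < e) even_at_top"
    unfolding eventually_even_at_top
  proof (intro exI[of _ "max (max N 1) (2 ^ J)"] allI impI)
    fix L :: nat assume L: "max (max N 1) (2 ^ J) \<le> L" "even L"
    then have pos: "L > 0" "2 ^ J \<le> L" "real N \<le> real L" by auto
    have "2 * \<bar>B J\<bar> / e < real L" using N pos by linarith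
    then have "B J / real L < e / 2" using \<open>e > 0\<close> pos by (auto simp: field_simps abs_if split: if_splits)
    then have "f L < e" using le[OF L(2) pos(1) \<open>J > 0\<close> pos(2) t] half by linarith
    then show "dist (f L) 0 < e" using nn[OF L(2) pos(1)] by simp
  qed
qed

theorem theorem3p7:
  fixes w :: "int \<Rightarrow> real" and \<epsilon> :: real
  assumes nonneg: "\<And>r. w r \<ge> 0"
    and symmetric: "\<And>r. w (- r) = w r"
    and lazy_bipartite: "\<And>r. even r \<Longrightarrow> r \<noteq> 0 \<Longrightarrow> w r = 0"
    and w0: "w 0 > 0"
    and first_moment: "(\<lambda>r. real_of_int \<bar>r\<bar> * w r) summable_on UNIV"
    and eps: "\<epsilon> > 0"
  shows "((\<lambda>L. measure (torus_mdd w L)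
            {\<omega> \<in> space (torus_mdd w L). real (torus_Lmax w L \<omega>) \<ge> \<epsilon> * real L})
            \<longlongrightarrow> 0) even_at_top
    \<and> ((\<lambda>L. (1 / real L) * (\<integral>\<omega>. real (torus_Lmax w L \<omega>) \<partial>torus_mdd w L))
            \<longlongrightarrow> 0) even_at_top
    \<and> ((\<lambda>L. (1 / real L) * (\<integral>\<omega>. real (torus_loop w L 0 \<omega>) \<partial>torus_mdd w L))
            \<longlongrightarrow> 0) even_at_top
    \<and> (torus_M w \<longlongrightarrow> 0) even_at_top"
proof -
  have model: "torus_model w L" if "even L" "L > 0" for L
    by unfold_locales (use that assms in auto)
  let ?X = "\<lambda>L. (1 / real L) * (\<integral>\<omega>. real (torus_Lmax w L \<omega>) \<partial>torus_mdd w L)"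
  have ev: "eventually (\<lambda>L. P L) even_at_top" if "\<And>L. torus_model w L \<Longrightarrow> P L" for P
    unfolding eventually_even_at_top by (rule exI[of _ 1]) (use that model in auto)
  \<comment> \<open>\<open>C\<close> is defined inside the locale but depends on \<open>w\<close>
    alone, so a single instance such as \<open>L = 2\<close> settles its sign. The same independence
    of \<open>L\<close>, also for \<open>R\<close>, makes the estimates below uniform.\<close>
  have c: "8 * torus_model.C w \<ge> 0" using torus_model.C_def[OF model[of 2]] by simp
  have "((\<lambda>L. (?X L)\<^sup>2) \<longlongrightarrow> 0) even_at_top"
  proof (rule tendsto_zero_even_at_top)
    let ?q = "(torus_model.R w / w 0)\<^sup>2"
    fix L J :: nat and t :: real
    assume *: "even L" "L > 0" "J > 0" "2 ^ J \<le> L" "t > 0"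
    interpret torus_model w L by (rule model) (use * in auto)
    show "(?X L)\<^sup>2 \<le> 4 * ?q * (8 * torus_model.C w / (real J * t) + t) + (4 + 16 * ?q * 2 ^ J) / real L"
      using ELmax_square_le[OF *(3-5)] by (simp only: ELmax_def err_def)
  qed (use c in auto)
  then have "((\<lambda>L. sqrt ((?X L)\<^sup>2)) \<longlongrightarrow> sqrt 0) even_at_top"
    by (rule tendsto_real_sqrt)
  then have X: "(?X \<longlongrightarrow> 0) even_at_top" by simp
  then have X': "((\<lambda>L. 1 / \<epsilon> * ?X L) \<longlongrightarrow> 0) even_at_top"
    using tendsto_mult_right_zero by blast
  have prob: "((\<lambda>L. measure (torus_mdd w L)
            {\<omega> \<in> space (torus_mdd w L). real (torus_Lmax w L \<omega>) \<ge> \<epsilon> * real L})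
            \<longlongrightarrow> 0) even_at_top"
  proof (rule tendsto_sandwich[OF _ _ tendsto_const X'])
    show "\<forall>\<^sub>F L in even_at_top. measure (torus_mdd w L)
        {\<omega> \<in> space (torus_mdd w L). real (torus_Lmax w L \<omega>) \<ge> \<epsilon> * real L} \<le> 1 / \<epsilon> * ?X L"
      by (rule ev) (use torus_model.torus_Lmax_markov[OF _ eps] torus_model.ELmax_def in force)
  qed auto
  have loop0: "((\<lambda>L. (1 / real L) * (\<integral>\<omega>. real (torus_loop w L 0 \<omega>) \<partial>torus_mdd w L))
            \<longlongrightarrow> 0) even_at_top"
  proof (rule tendsto_sandwich[OF _ _ tendsto_const X])
    show "\<forall>\<^sub>F L in even_at_top. (1 / real L) * (\<integral>\<omega>. real (torus_loop w L 0 \<omega>) \<partial>torus_mdd w L) \<le> ?X L"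
      by (rule ev, rule mult_left_mono)
        (use torus_model.torus_loop_expectation_le torus_model.ELmax_def in force)+
  qed auto
  have "(torus_M w \<longlongrightarrow> 0) even_at_top"
  proof (rule tendsto_zero_even_at_top)
    show "0 \<le> torus_M w L" if "even L" "L > 0" for L
      by (rule torus_model.torus_M_nonneg[OF model[OF that]])
    let ?c = "((1 / w 0)\<^sup>2 + 1) / 2"
    fix L J :: nat and t :: real
    assume *: "even L" "L > 0" "J > 0" "2 ^ J \<le> L" "t > 0"
    interpret torus_model w L by (rule model) (use * in auto)
    show "torus_M w L \<le> ?c * (8 * torus_model.C w / (real J * t) + t) + ?c * (2 * 2 ^ J) / real L"
      using torus_M_le[OF *(3-5)] unfolding err_def by (simp only: distrib_left times_divide_eq_right)
  qed (use c in auto)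
  with X prob loop0 show ?thesis by blast
qed

end
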